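(* Let $n\ge 4$ and let $W_n$ be the wheel graph on $n$ vertices. Then \[ M_2(W_n)\simeq\begin{cases} S^2\vee S^2\vee S^2 & n=4,\\ S^3\vee S^3 & n=5,\\ \text{a point} & n\ge 6.\end{cases} \]
   Context: The wheel graph $W_n$ on $n$ vertices is obtained from a cycle on $n-1$ vertices by adding one new vertex adjacent to every vertex of the cycle. A $2$-matching of a graph $G$ is a set of edges $H\subseteq E(G)$ such that every vertex has degree at most $2$ in $H$. The $2$-matching complex $M_2(G)$ is the simplicial complex whose vertices are the edges of $G$ and whose faces are the $2$-matchings of $G$. $\simeq$ denotes homotopy equivalence. *)

theory Defs
  imports "HOL-Analysis.Analysis"
begin

definition wheel_edges :: "nat \<Rightarrow> nat set set" where
  "wheel_edges n =
     {{0, i} | i. 1 \<le> i \<and> i \<le> n - 1}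
   \<union> {{i, i + 1} | i. 1 \<le> i \<and> i < n - 1}
   \<union> {{n - 1, 1}}"

definition two_matching :: "'v set set \<Rightarrow> 'v set set \<Rightarrow> bool" where
  "two_matching E H \<longleftrightarrow> H \<subseteq> E \<and> (\<forall>v. card {e \<in> H. v \<in> e} \<le> 2)"

definition two_matching_complex :: "'v set set \<Rightarrow> 'v set set set" where
  "two_matching_complex E = {H. two_matching E H}"

text \<open>For a finite vertex set V and a family K of faces (subsets of V),
  the realization consists of all barycentric-coordinate functions whose support
  is a face; topologised as a subspace of the product topology on 'a \<Rightarrow> real
  (which on finitely supported functions is the Euclidean topology).\<close>

definition realization :: "'a set \<Rightarrow> 'a set set \<Rightarrow> ('a \<Rightarrow> real) set" where
  "realization V K = {f. (\<forall>v. 0 \<le> f v) \<and> (\<forall>v. v \<notin> V \<longrightarrow> f v = 0)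
                          \<and> sum f V = 1 \<and> {v. f v \<noteq> 0} \<in> K}"

definition realization_space :: "'a set \<Rightarrow> 'a set set \<Rightarrow> ('a \<Rightarrow> real) topology" where
  "realization_space V K = subtopology (powertop_real UNIV) (realization V K)"

text \<open>The wedge of k copies of S^d: the i-th sphere (i < k) lives in the coordinate block
  {i} \<times> {0..d}, is the unit sphere centred at the unit vector e_(i,0); all spheres pass through
  the origin and any two meet only there.\<close>

definition wedge_spheres_set :: "nat \<Rightarrow> nat \<Rightarrow> (nat \<times> nat \<Rightarrow> real) set" where
  "wedge_spheres_set k d =
     (\<Union>i<k. {x. (\<forall>p. p \<notin> {i} \<times> {..d} \<longrightarrow> x p = 0) \<and>
               (\<Sum>j\<le>d. (x (i, j) - (if j = 0 then 1 else 0))\<^sup>2) = 1})"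

definition wedge_spheres :: "nat \<Rightarrow> nat \<Rightarrow> (nat \<times> nat \<Rightarrow> real) topology" where
  "wedge_spheres k d = subtopology (powertop_real UNIV) (wedge_spheres_set k d)"

end

theory Submission
  imports Defs
begin

text \<open>A face of \<open>M\<^sub>2(W\<^sub>n)\<close> contains at most two spokes. If the link of a face \<open>\<sigma>\<close> is a cone, the open star
  of \<open>\<sigma>\<close> can be removed without changing the homotopy type. For \<open>n \<ge> 6\<close> some rim edge misses both
  endpoints of any given pair of spokes and serves as apex for its link; removing all pairs and then
  all single spokes leaves the full simplex on the rim.

  For \<open>n = 4\<close> (\<open>n = 5\<close>) the same collapses work once one maximal cell is removed for each of the three
  pairs of spokes (the two pairs of opposite spokes). So the complex is a collapsible complex with
  three \<open>2\<close>-cells (two \<open>3\<close>-cells) attached. Coning off the collapsible part does not change the homotopy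
  type, and in the resulting complex every cell together with the cone over its boundary is the
  boundary of a simplex, these spheres being glued at the apex up to homotopy.\<close>

section \<open>Homotopies between sets of real functions\<close>

text \<open>The cases differ in the link of a pair of spokes. For n = 4 this link has two
  components, a point and a segment; for n = 5 the link of an opposite pair is a circle of four
  edges. Removing one maximal cell turns each of them into something that collapses, and this fixes
  the number and the dimension of the cells.

  The cells have no common point, so the wedge is not visible in the complex itself, and collapsing
  the rest there would drag the boundaries of the cells along. The remedy is to collapse elsewhere:
  a new vertex \<open>p\<close> is coned over the complex L without the cells. The link of
  \<open>p\<close> is L, so a collapse of L at \<sigma> with apex w becomes a collapse of the larger
  complex at \<sigma> together with \<open>p\<close>, and the cells stay untouched. The larger
  complex is compared with a wedge by explicit formulas in barycentric coordinates, in place of a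
  quotient space.\<close>

lemma realization_space_eq: "realization_space V K = top_of_set (realization V K)"
  by (simp add: realization_space_def euclidean_product_topology)

lemma wedge_spheres_eq: "wedge_spheres k d = top_of_set (wedge_spheres_set k d)"
  by (simp add: wedge_spheres_def euclidean_product_topology)

lemma continuous_on_coordinate [continuous_intros]:
  "continuous_on S (\<lambda>x. x i :: 'b::topological_space)"
  by (rule continuous_on_subset[OF continuous_on_product_coordinates]) simp

lemma continuous_on_snd_coordinate [continuous_intros]:
  "continuous_on S (\<lambda>z. snd z i :: 'b::topological_space)"
  by (rule continuous_on_product_then_coordinatewise) (rule continuous_on_snd[OF continuous_on_id])

lemma continuous_on_Min [continuous_intros]:
  fixes f :: "'i \<Rightarrow> 'a::topological_space \<Rightarrow> real"
  assumes "finite I" "I \<noteq> {}" "\<And>i. i \<in> I \<Longrightarrow> continuous_on S (f i)"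
  shows "continuous_on S (\<lambda>x. Min ((\<lambda>i. f i x) ` I))"
  using assms
proof (induction I rule: finite_ne_induct)
  case (insert i I)
  then have "continuous_on S (\<lambda>x. min (f i x) (Min ((\<lambda>i. f i x) ` I)))"
    by (intro continuous_on_min) auto
  then show ?case
    using insert by simp
qed auto

lemma homotopic_canonI:
  fixes h :: "real \<Rightarrow> 'a::topological_space \<Rightarrow> 'b::topological_space"
  assumes "continuous_on ({0..1} \<times> S) (\<lambda>z. h (fst z) (snd z))"
    and "\<And>s x. 0 \<le> s \<Longrightarrow> s \<le> 1 \<Longrightarrow> x \<in> S \<Longrightarrow> h s x \<in> T"
    and "\<And>x. x \<in> S \<Longrightarrow> h 0 x = f x" "\<And>x. x \<in> S \<Longrightarrow> h 1 x = g x"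
  shows "homotopic_with_canon (\<lambda>_. True) S T f g"
proof -
  define H where "H z = h (fst z) (snd z)" for z
  have "continuous_map (prod_topology (top_of_set {0..1}) (top_of_set S)) (top_of_set T) H"
    using assms(1,2) by (auto simp: prod_topology_subtopology_eu H_def)
  moreover have "\<forall>x\<in>topspace (top_of_set S). H (0, x) = f x" "\<forall>x\<in>topspace (top_of_set S). H (1, x) = g x"
    using assms(3,4) by (simp_all add: H_def)
  ultimately have "\<exists>h. continuous_map (prod_topology (top_of_set {0..1::real}) (top_of_set S)) (top_of_set T) h
         \<and> (\<forall>x\<in>topspace (top_of_set S). h (0, x) = f x)
         \<and> (\<forall>x\<in>topspace (top_of_set S). h (1, x) = g x) \<and> (\<forall>t\<in>{0..1::real}. True)"
    by (intro exI[of _ H] conjI) simp_all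
  then show ?thesis
    by (subst homotopic_with) simp_all
qed

lemma homotopic_segments:
  fixes f g :: "'a::topological_space \<Rightarrow> 'b \<Rightarrow> real"
  assumes f: "continuous_on S f" and g: "continuous_on S g"
    and seg: "\<And>s x. 0 \<le> s \<Longrightarrow> s \<le> 1 \<Longrightarrow> x \<in> S \<Longrightarrow> (\<lambda>v. (1 - s) * f x v + s * g x v) \<in> T"
  shows "homotopic_with_canon (\<lambda>_. True) S T f g"
proof (rule homotopic_canonI)
  have *: "continuous_on ({0..1::real} \<times> S) (\<lambda>z. f (snd z))" "continuous_on ({0..1::real} \<times> S) (\<lambda>z. g (snd z))"
    using continuous_on_compose2[OF f continuous_on_snd[OF continuous_on_id], of "{0..1::real} \<times> S"]
      continuous_on_compose2[OF g continuous_on_snd[OF continuous_on_id], of "{0..1::real} \<times> S"] by simp_all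
  show "continuous_on ({0..1} \<times> S) (\<lambda>z v. (1 - fst z) * f (snd z) v + fst z * g (snd z) v)"
    by (intro continuous_on_coordinatewise_then_product continuous_on_add continuous_on_mult continuous_on_diff
          continuous_on_fst continuous_on_const continuous_on_id *[THEN continuous_on_product_then_coordinatewise])
qed (rule seg, assumption+, simp_all)

lemma homotopy_eqvI:
  assumes "continuous_on S f" "f ` S \<subseteq> T" "continuous_on T g" "g ` T \<subseteq> S"
    and "homotopic_with_canon (\<lambda>_. True) S S id (g \<circ> f)"
    and "homotopic_with_canon (\<lambda>_. True) T T id (f \<circ> g)"
  shows "S homotopy_eqv T"
proof -
  have "continuous_map (top_of_set S) (top_of_set T) f" "continuous_map (top_of_set T) (top_of_set S) g"
    using assms(1-4) by (simp_all add: continuous_map_subtopology_eu image_subset_iff_funcset)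
  then show ?thesis
    unfolding homotopy_equivalent_space_def
    by (intro exI[of _ f] exI[of _ g] conjI homotopic_with_symD[OF assms(5)] homotopic_with_symD[OF assms(6)])
qed

section \<open>Generalized collapses\<close>

lemma realizationD:
  assumes "f \<in> realization V K"
  shows "0 \<le> f v" "v \<notin> V \<Longrightarrow> f v = 0" "sum f V = 1" "{v. f v \<noteq> 0} \<in> K"
  using assms by (auto simp: realization_def)

text \<open>A vertex that lies in no face has coordinate 0 at every point, so enlarging the ambient
  vertex set changes nothing. This lets the auxiliary apex be discarded once its star has been
  collapsed.\<close>

lemma realization_mono_vertices:
  assumes "finite V'" "V \<subseteq> V'" "\<And>\<tau>. \<tau> \<in> K \<Longrightarrow> \<tau> \<subseteq> V"
  shows "realization V' K = realization V K"
proof -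
  have "f \<in> realization V' K \<longleftrightarrow> f \<in> realization V K" for f
  proof (cases "{v. f v \<noteq> 0} \<in> K")
    case True
    then have zero: "f v = 0" if "v \<notin> V" for v
      using assms(3) that by blast
    then have "sum f V' = sum f V"
      using assms by (intro sum.mono_neutral_right) auto
    then show ?thesis
      using zero \<open>V \<subseteq> V'\<close> by (auto simp: realization_def)
  qed (auto simp: realization_def)
  then show ?thesis
    by blast
qed

text \<open>If the link of \<open>\<sigma>\<close> is a cone with apex \<open>w\<close>, moving the smallest barycentric coordinate on
  \<open>\<sigma>\<close> from every vertex of \<open>\<sigma>\<close> to \<open>w\<close> retracts the complex onto the complement of the open star.\<close>

lemma collapse_homotopy_eqv:
  fixes V :: "'a set" and K :: "'a set set"
  assumes V: "finite V" and \<sigma>: "\<sigma> \<subseteq> V" "\<sigma> \<noteq> {}" and w: "w \<in> V" "w \<notin> \<sigma>"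
    and down: "\<And>\<tau> \<tau>'. \<tau> \<in> K \<Longrightarrow> \<tau>' \<subseteq> \<tau> \<Longrightarrow> \<tau>' \<in> K"
    and cone: "\<And>\<tau>. \<tau> \<in> K \<Longrightarrow> \<sigma> \<subseteq> \<tau> \<Longrightarrow> insert w \<tau> \<in> K"
  shows "realization V K homotopy_eqv realization V {\<tau>\<in>K. \<not> \<sigma> \<subseteq> \<tau>}"
proof -
  have fin: "finite \<sigma>"
    using V \<sigma> finite_subset by blast
  define m where "m f = Min ((\<lambda>v. f v) ` \<sigma>)" for f :: "'a \<Rightarrow> real"
  define r where "r f = (\<lambda>v. f v - (if v \<in> \<sigma> then m f else 0) + (if v = w then card \<sigma> * m f else 0))"
    for f :: "'a \<Rightarrow> real"
  have m_le: "m f \<le> f v" if "v \<in> \<sigma>" for f v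
    using that fin by (simp add: m_def)
  have m_attained: "\<exists>v\<in>\<sigma>. m f = f v" for f
  proof -
    have "m f \<in> (\<lambda>v. f v) ` \<sigma>"
      unfolding m_def using fin \<sigma> by (intro Min_in) auto
    then show ?thesis by auto
  qed
  have m_nonneg: "0 \<le> m f" if "f \<in> realization V K" for f
    using m_attained[of f] realizationD(1)[OF that] by metis
  have m_zero: "m f = 0" if f: "f \<in> realization V K" and nsub: "\<not> \<sigma> \<subseteq> {v. f v \<noteq> 0}" for f
  proof -
    obtain v where "v \<in> \<sigma>" "f v = 0"
      using nsub by blast
    then show ?thesis
      using m_le[of v f] m_nonneg[OF f] by simp
  qed
  have contm: "continuous_on S m" for S
    unfolding m_def using fin \<sigma> by (intro continuous_on_Min) (auto intro: continuous_on_coordinate)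
  have cont: "continuous_on S r" for S
  proof (rule continuous_on_coordinatewise_then_product)
    show "continuous_on S (\<lambda>f. r f v)" for v
      unfolding r_def by (cases "v \<in> \<sigma>"; cases "v = w"; simp; intro continuous_intros contm)
  qed
  have seg_eq: "(\<lambda>v. (1 - s) * f v + s * r f v) =
       (\<lambda>v. f v - (if v \<in> \<sigma> then s * m f else 0) + (if v = w then s * (card \<sigma> * m f) else 0))" for s f
    by (auto simp: r_def algebra_simps)
  have seg: "(\<lambda>v. (1 - s) * f v + s * r f v) \<in> realization V K"
    if f: "f \<in> realization V K" and s: "0 \<le> s" "s \<le> 1" for s f
  \<comment> \<open>Outside the open star of \<sigma> the minimum \<open>m f\<close> is 0 and the
    path is constant; inside it the support gains at most \<open>w\<close>, which the cone
    hypothesis permits.\<close>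
  proof (cases "\<sigma> \<subseteq> {v. f v \<noteq> 0}")
    case True
    have bound: "s * m f \<le> f v" if "v \<in> \<sigma>" for v
      using m_le[OF that, of f] m_nonneg[OF f] s mult_left_le_one_le[of "m f" s] by linarith
    let ?g = "\<lambda>v. f v - (if v \<in> \<sigma> then s * m f else 0) + (if v = w then s * (card \<sigma> * m f) else 0)"
    have "sum ?g V = sum f V - (\<Sum>v\<in>V. if v \<in> \<sigma> then s * m f else 0) + (\<Sum>v\<in>V. if v = w then s * (card \<sigma> * m f) else 0)"
      by (simp add: sum.distrib sum_subtractf)
    also have "(\<Sum>v\<in>V. if v \<in> \<sigma> then s * m f else 0) = (\<Sum>v\<in>\<sigma>. s * m f)"
      using V \<sigma> by (simp add: sum.If_cases Int_absorb1)
    also have "(\<Sum>v\<in>V. if v = w then s * (card \<sigma> * m f) else 0) = s * (card \<sigma> * m f)"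
      using V w by simp
    finally have sum: "sum ?g V = 1"
      using realizationD(3)[OF f] by simp
    have "{v. ?g v \<noteq> 0} \<subseteq> insert w {v. f v \<noteq> 0}"
      using True by auto
    then have "{v. ?g v \<noteq> 0} \<in> K"
      using cone[OF realizationD(4)[OF f] True] down by blast
    moreover have "0 \<le> ?g v" for v
      using bound[of v] m_nonneg[OF f] s realizationD(1)[OF f, of v] w by auto
    moreover have "?g v = 0" if "v \<notin> V" for v
      using that w \<sigma> realizationD(2)[OF f, of v] by auto
    ultimately show ?thesis
      unfolding seg_eq realization_def using sum by simp
  next
    case False
    then have "(\<lambda>v. (1 - s) * f v + s * r f v) = f"
      unfolding seg_eq using m_zero[OF f] by auto
    then show ?thesis using f by simp
  qed
  let ?L = "{\<tau>\<in>K. \<not> \<sigma> \<subseteq> \<tau>}"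
  have sub: "realization V ?L \<subseteq> realization V K"
    by (auto simp: realization_def)
  have r_id: "r f = f" if "f \<in> realization V ?L" for f
  proof -
    have "m f = 0"
      using that sub m_zero realizationD(4)[OF that] by auto
    then show ?thesis by (auto simp: r_def)
  qed
  have r_K: "r f \<in> realization V K" if "f \<in> realization V K" for f
    using seg[OF that, of 1] by simp
  have r_L: "r f \<in> realization V ?L" if f: "f \<in> realization V K" for f
  proof -
    obtain v where "v \<in> \<sigma>" "m f = f v"
      using m_attained by blast
    then have "v \<in> \<sigma>" "r f v = 0"
      using w by (auto simp: r_def)
    then show ?thesis
      using r_K[OF f] by (auto simp: realization_def)
  qed
  have cont_id: "continuous_on S id" for S :: "('a \<Rightarrow> real) set"
    by (simp add: id_def)
  show ?thesis
  proof (rule homotopy_eqvI[of _ r _ id])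
    show "homotopic_with_canon (\<lambda>_. True) (realization V K) (realization V K) id (id \<circ> r)"
      unfolding id_comp by (rule homotopic_segments[OF cont_id cont]) (simp add: seg)
    show "homotopic_with_canon (\<lambda>_. True) (realization V ?L) (realization V ?L) id (r \<circ> id)"
      by (rule homotopic_with_equal) (simp_all add: r_id)
    show "id ` realization V ?L \<subseteq> realization V K"
      using sub by simp
  qed (use r_L in \<open>simp_all add: cont cont_id image_subset_iff\<close>)
qed

section \<open>Cells attached to a cone\<close>

text \<open>Each of the \<open>k\<close> simplices has \<open>d + 2\<close> vertices, one of which is the common base point; its
  barycentric coordinate \<open>1 - (\<Sum>j\<le>d. x (i, j))\<close> is left implicit, so the base point is \<open>0\<close>.\<close>

definition simplex_boundary_wedge :: "nat \<Rightarrow> nat \<Rightarrow> (nat \<times> nat \<Rightarrow> real) set" where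
  "simplex_boundary_wedge k d =
     (\<Union>i<k. {x. (\<forall>q. 0 \<le> x q) \<and> (\<forall>q. q \<notin> {i} \<times> {..d} \<longrightarrow> x q = 0) \<and> (\<Sum>j\<le>d. x (i, j)) \<le> 1 \<and>
               ((\<Sum>j\<le>d. x (i, j)) = 1 \<or> (\<exists>j\<le>d. x (i, j) = 0))})"

lemma simplex_boundary_wedgeI:
  assumes "i < k" "\<And>q. 0 \<le> x q" "\<And>q. q \<notin> {i} \<times> {..d} \<Longrightarrow> x q = 0" "(\<Sum>j\<le>d. x (i, j)) \<le> 1"
    "(\<Sum>j\<le>d. x (i, j)) = 1 \<or> (\<exists>j\<le>d. x (i, j) = 0)"
  shows "x \<in> simplex_boundary_wedge k d"
  unfolding simplex_boundary_wedge_def using assms by blast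

lemma simplex_boundary_wedgeE:
  assumes "x \<in> simplex_boundary_wedge k d"
  obtains i where "i < k" "\<And>q. 0 \<le> x q" "\<And>q. q \<notin> {i} \<times> {..d} \<Longrightarrow> x q = 0" "(\<Sum>j\<le>d. x (i, j)) \<le> 1"
    "(\<Sum>j\<le>d. x (i, j)) = 1 \<or> (\<exists>j\<le>d. x (i, j) = 0)"
  using assms unfolding simplex_boundary_wedge_def by blast

text \<open>On a simplex with smallest coordinate \<open>m\<close> and \<open>\<mu> = (d + 1) * m\<close>, the point \<open>y\<close> is the mixture of the
  barycentre and a boundary point with weights \<open>\<mu>\<close> and \<open>1 - \<mu>\<close>. The map stretches \<open>\<mu> \<in> [s / (1 + s), 1]\<close> to
  \<open>[0, 1]\<close> and shrinks the coordinates of the remaining points; at \<open>s = 1\<close> it sends the boundary to \<open>0\<close>,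
  that is, to the apex of the cone.\<close>

definition blow :: "nat \<Rightarrow> real \<Rightarrow> real \<Rightarrow> real \<Rightarrow> real" where
  "blow d s m y = min (1 + s) (1 - s + 2 * (1 + s) * (real (Suc d) * m)) * (y - m)
                + max 0 ((1 + s) * (real (Suc d) * m) - s) / real (Suc d)"

lemma blow_start: "0 \<le> m \<Longrightarrow> blow d 0 m y = y"
  by (simp add: blow_def max_def)

text \<open>A zero minimum occurs on the boundary of a cell and everywhere outside it. There the
  formula is plain scaling towards the apex, so the motion inside a cell and the contraction of the
  rest fit together along the boundary.\<close>

lemma blow_zero: "0 \<le> s \<Longrightarrow> blow d s 0 y = (1 - s) * y"
  by (simp add: blow_def max_def min_def)

text \<open>The line \<open>1 - s + 2 * (1 + s) * \<mu>\<close> rises from \<open>1 - s\<close> at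
  \<mu> = 0 to \<open>1 + s\<close> at \<mu> = s / (1 + s), exactly where the second summand of
  \<open>blow\<close> becomes positive. Beyond that value the coordinates sum to 1. Before it the
  second summand is 0, so the coordinate attaining the minimum becomes 0 and only the bound on the
  sum remains.\<close>

lemma blow_simplex:
  fixes y :: "nat \<Rightarrow> real"
  assumes s: "0 \<le> s" "s \<le> 1" and y: "\<And>j. j \<le> d \<Longrightarrow> 0 \<le> y j" and sum: "(\<Sum>j\<le>d. y j) = 1"
    and m: "m = Min (y ` {..d})"
  defines "z \<equiv> \<lambda>j. blow d s m (y j)"
  shows "\<And>j. j \<le> d \<Longrightarrow> 0 \<le> z j" and "(\<Sum>j\<le>d. z j) \<le> 1" and "(\<Sum>j\<le>d. z j) = 1 \<or> (\<exists>j\<le>d. z j = 0)"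
proof -
  define \<mu> where "\<mu> = real (Suc d) * m"
  define c where "c = min (1 + s) (1 - s + 2 * (1 + s) * \<mu>)"
  define e where "e = max 0 ((1 + s) * \<mu> - s)"
  have z: "z j = c * (y j - m) + e / real (Suc d)" for j
    by (simp add: z_def blow_def c_def e_def \<mu>_def)
  have m_le: "m \<le> y j" if "j \<le> d" for j
    using that by (simp add: m)
  have "m \<in> y ` {..d}"
    unfolding m by (rule Min_in) auto
  then obtain j0 where j0: "j0 \<le> d" "y j0 = m"
    by auto
  then have "0 \<le> m"
    using y by metis
  then have \<mu>0: "0 \<le> \<mu>"
    by (simp add: \<mu>_def)
  have sumz: "(\<Sum>j\<le>d. z j) = c * (1 - \<mu>) + e"
  proof -
    have "(\<Sum>j\<le>d. z j) = c * ((\<Sum>j\<le>d. y j) - real (Suc d) * m) + e"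
      by (simp add: z sum.distrib sum_subtractf flip: sum_distrib_left)
    then show ?thesis by (simp add: sum \<mu>_def)
  qed
  have c0: "0 \<le> c"
    using s \<mu>0 by (simp add: c_def)
  show "0 \<le> z j" if "j \<le> d" for j
    using c0 m_le[OF that] by (simp add: z e_def)
  have "(\<Sum>j\<le>d. z j) \<le> 1 \<and> ((\<Sum>j\<le>d. z j) = 1 \<or> (\<exists>j\<le>d. z j = 0))"
  proof (cases "s < (1 + s) * \<mu>")
    case True
    then have "c = 1 + s"
      unfolding c_def by (intro min_absorb1) linarith
    moreover have "e = (1 + s) * \<mu> - s"
      using True by (simp add: e_def)
    ultimately have "(\<Sum>j\<le>d. z j) = 1"
      by (simp add: sumz algebra_simps)
    then show ?thesis by simp
  next
    case False
    then have e: "e = 0"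
      by (simp add: e_def)
    \<comment> \<open>Here \<mu> \<le> s / (1 + s), which is at most 1 / 2 because s \<le> 1. The
      bound makes the last factor of the product below nonnegative.\<close>
    have \<mu>: "\<mu> \<le> 1 / 2"
    proof (rule ccontr)
      assume "\<not> \<mu> \<le> 1 / 2"
      then have "(1 + s) * (1 / 2) < (1 + s) * \<mu>"
        using s by (intro mult_strict_left_mono) auto
      moreover have "(1 + s) * (1 / 2) = 1 / 2 + s / 2"
        by (simp add: field_simps)
      ultimately have "1 / 2 + s / 2 < (1 + s) * \<mu>"
        by metis
      then show False
        using False s by linarith
    qed
    have "c * (1 - \<mu>) \<le> (1 - s + 2 * (1 + s) * \<mu>) * (1 - \<mu>)"
      using \<mu> by (intro mult_right_mono) (auto simp: c_def)
    also have "\<dots> = 1 - (s - (1 + s) * \<mu>) * (1 - 2 * \<mu>)"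
      by (simp add: algebra_simps power2_eq_square)
    also have "\<dots> \<le> 1"
      using False \<mu> by simp
    finally have "(\<Sum>j\<le>d. z j) \<le> 1"
      by (simp add: sumz e)
    moreover have "z j0 = 0"
      by (simp add: z j0 e)
    ultimately show ?thesis
      using j0 by blast
  qed
  then show "(\<Sum>j\<le>d. z j) \<le> 1" "(\<Sum>j\<le>d. z j) = 1 \<or> (\<exists>j\<le>d. z j = 0)"
    by auto
qed

lemma continuous_on_blow [continuous_intros]:
  assumes "continuous_on S s" "continuous_on S m" "continuous_on S y"
  shows "continuous_on S (\<lambda>x. blow d (s x) (m x) (y x))"
  unfolding blow_def by (intro continuous_intros assms) auto

text \<open>A complex in which all faces but the \<open>k\<close> maximal cells \<open>\<nu> i ` {..d}\<close> lie in the cone with apex \<open>p\<close>.\<close>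

locale coned_cells =
  fixes V :: "'a set" and K :: "'a set set" and p :: 'a and \<nu> :: "nat \<Rightarrow> nat \<Rightarrow> 'a" and k d :: nat
  assumes finV: "finite V" and pV: "p \<in> V" and KV: "\<And>\<tau>. \<tau> \<in> K \<Longrightarrow> \<tau> \<subseteq> V"
    and down: "\<And>\<tau> \<tau>'. \<tau> \<in> K \<Longrightarrow> \<tau>' \<subseteq> \<tau> \<Longrightarrow> \<tau>' \<in> K"
    and k: "0 < k"
    and inj: "\<And>i. i < k \<Longrightarrow> inj_on (\<nu> i) {..d}"
    and apex: "\<And>i j. i < k \<Longrightarrow> j \<le> d \<Longrightarrow> \<nu> i j \<noteq> p"
    and cell: "\<And>i. i < k \<Longrightarrow> \<nu> i ` {..d} \<in> K"
    and cells_distinct: "\<And>i i'. i < k \<Longrightarrow> i' < k \<Longrightarrow> \<nu> i ` {..d} = \<nu> i' ` {..d} \<Longrightarrow> i = i'"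
    and cell_maximal: "\<And>i \<tau>. i < k \<Longrightarrow> \<tau> \<in> K \<Longrightarrow> \<nu> i ` {..d} \<subseteq> \<tau> \<Longrightarrow> \<tau> = \<nu> i ` {..d}"
    and coned: "\<And>\<tau>. \<tau> \<in> K \<Longrightarrow> (\<And>i. i < k \<Longrightarrow> \<tau> \<noteq> \<nu> i ` {..d}) \<Longrightarrow> insert p \<tau> \<in> K"
begin

lemma vertex_eq: "i < k \<Longrightarrow> j \<le> d \<Longrightarrow> j' \<le> d \<Longrightarrow> \<nu> i j = \<nu> i j' \<longleftrightarrow> j = j'"
  using inj by (auto simp: inj_on_def)

lemma vertex_in: "i < k \<Longrightarrow> j \<le> d \<Longrightarrow> \<nu> i j \<in> V"
  using KV[OF cell] by auto

lemma vertex_sum: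
  assumes "i < k" "j \<le> d"
  shows "(\<Sum>j'\<le>d. if \<nu> i j' = \<nu> i j then f j' else (0::real)) = f j"
proof -
  have "(\<Sum>j'\<le>d. if \<nu> i j' = \<nu> i j then f j' else 0) = (\<Sum>j'\<le>d. if j' = j then f j' else 0)"
    using assms by (intro sum.cong) (auto simp: vertex_eq)
  then show ?thesis
    using assms by simp
qed

text \<open>Cell \<open>i\<close> and the cone over its boundary form the boundary of the simplex
  spanned by the cell and \<open>p\<close>; the weight missing in \<open>z\<close> goes to
  \<open>p\<close>. If none is missing, the support lies in the cell. Otherwise some
  \<open>z j\<close> is 0; by maximality a proper face of a cell is never itself a cell, so
  \<open>coned\<close> applies.\<close>

lemma cell_point:
  assumes i: "i < k" and z: "\<And>j. j \<le> d \<Longrightarrow> 0 \<le> z j" "(\<Sum>j\<le>d. z j) \<le> 1"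
      "(\<Sum>j\<le>d. z j) = 1 \<or> (\<exists>j\<le>d. z j = 0)"
    and g: "\<And>j. j \<le> d \<Longrightarrow> g (\<nu> i j) = z j" "g p = 1 - (\<Sum>j\<le>d. z j)"
      "\<And>v. v \<noteq> p \<Longrightarrow> v \<notin> \<nu> i ` {..d} \<Longrightarrow> g v = 0"
  shows "g \<in> realization V K"
proof -
  have "sum g V = sum g (insert p (\<nu> i ` {..d}))"
    using finV pV vertex_in[OF i] g(3) by (intro sum.mono_neutral_right) auto
  also have "\<dots> = g p + sum g (\<nu> i ` {..d})"
    using apex[OF i] by (subst sum.insert) auto
  also have "sum g (\<nu> i ` {..d}) = (\<Sum>j\<le>d. z j)"
    using inj[OF i] by (subst sum.reindex) (auto simp: g)
  finally have "sum g V = 1"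
    by (simp add: g)
  moreover have "0 \<le> g v" for v
  proof (cases "v \<in> insert p (\<nu> i ` {..d})")
    case True
    then show ?thesis using g(1,2) z(1,2) by auto
  qed (use g(3) in auto)
  moreover have "g v = 0" if "v \<notin> V" for v
    using that pV vertex_in[OF i] g(3)[of v] by auto
  moreover have "{v. g v \<noteq> 0} \<in> K"
  proof (cases "(\<Sum>j\<le>d. z j) = 1")
    case True
    then have "g p = 0"
      by (simp add: g)
    then have "{v. g v \<noteq> 0} \<subseteq> \<nu> i ` {..d}"
      using g(3) by (metis (mono_tags, lifting) mem_Collect_eq subsetI)
    then show ?thesis
      using down cell[OF i] by blast
  next
    case False
    then obtain j where j: "j \<le> d" "z j = 0"
      using z(3) by blast
    let ?\<tau> = "\<nu> i ` {..d} - {\<nu> i j}"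
    have "?\<tau> \<in> K"
      using down[OF cell[OF i]] by blast
    moreover have "?\<tau> \<noteq> \<nu> i' ` {..d}" if i': "i' < k" for i'
    proof
      assume eq: "?\<tau> = \<nu> i' ` {..d}"
      then have "\<nu> i ` {..d} = \<nu> i' ` {..d}"
        using cell_maximal[OF i' cell[OF i]] by blast
      then show False
        using eq j by blast
    qed
    ultimately have "insert p ?\<tau> \<in> K"
      by (rule coned)
    moreover have "{v. g v \<noteq> 0} \<subseteq> insert p ?\<tau>"
      using g j by auto
    ultimately show ?thesis
      using down by blast
  qed
  ultimately show ?thesis
    by (simp add: realization_def)
qed

section \<open>Maps between the complex and the wedge, and homotopies for their composites\<close>

definition cell_min :: "nat \<Rightarrow> ('a \<Rightarrow> real) \<Rightarrow> real" where
  "cell_min i g = Min ((\<lambda>j. g (\<nu> i j)) ` {..d})"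

definition block_min :: "nat \<Rightarrow> (nat \<times> nat \<Rightarrow> real) \<Rightarrow> real" where
  "block_min i x = Min ((\<lambda>j. x (i, j)) ` {..d})"

text \<open>The coordinate at \<open>p\<close> is not copied, being implicit in the wedge. A point
  in no open cell has all minima 0 and lands on the base point, because \<open>blow\<close> at s = 1
  then multiplies by 0.\<close>

definition spread :: "('a \<Rightarrow> real) \<Rightarrow> nat \<times> nat \<Rightarrow> real" where
  "spread g = (\<lambda>(i, j). if i < k \<and> j \<le> d then blow d 1 (cell_min i g) (g (\<nu> i j)) else 0)"

definition fold_wedge :: "(nat \<times> nat \<Rightarrow> real) \<Rightarrow> 'a \<Rightarrow> real" where
  "fold_wedge x = (\<lambda>v. (\<Sum>i<k. \<Sum>j\<le>d. if \<nu> i j = v then x (i, j) else 0)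
                     + (if v = p then 1 - (\<Sum>i<k. \<Sum>j\<le>d. x (i, j)) else 0))"

text \<open>A vertex may lie in several cells, so the cells act by additive corrections to the
  scaling by \<open>1 - s\<close>. The correction of a cell vanishes outside its interior by
  \<open>blow_zero\<close>, hence at each point of the complex at most one cell contributes.\<close>

definition push :: "real \<Rightarrow> ('a \<Rightarrow> real) \<Rightarrow> 'a \<Rightarrow> real" where
  "push s g v = (1 - s) * g v
     + (\<Sum>i<k. \<Sum>j\<le>d. if \<nu> i j = v then blow d s (cell_min i g) (g v) - (1 - s) * g v else 0)"

definition complex_homotopy :: "real \<Rightarrow> ('a \<Rightarrow> real) \<Rightarrow> 'a \<Rightarrow> real" where
  "complex_homotopy s g = (\<lambda>v. if v = p then 1 - sum (push s g) (V - {p}) else push s g v)"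

definition wedge_homotopy :: "real \<Rightarrow> (nat \<times> nat \<Rightarrow> real) \<Rightarrow> nat \<times> nat \<Rightarrow> real" where
  "wedge_homotopy s x = (\<lambda>(i, j). if i < k \<and> j \<le> d then blow d s (block_min i x) (x (i, j)) else 0)"

text \<open>By maximality a support that contains a cell equals it, so every other support misses a
  vertex of the cell. Thus a nonzero \<open>cell_min i\<close> detects the open cell.\<close>

lemma cell_min_zero:
  assumes g: "g \<in> realization V K" and i: "i < k" and supp: "{v. g v \<noteq> 0} \<noteq> \<nu> i ` {..d}"
  shows "cell_min i g = 0"
proof -
  have "\<not> \<nu> i ` {..d} \<subseteq> {v. g v \<noteq> 0}"
    using cell_maximal[OF i realizationD(4)[OF g]] supp by blast
  then obtain j where "j \<le> d" "g (\<nu> i j) = 0"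
    by auto
  then show ?thesis
    unfolding cell_min_def using realizationD(1)[OF g] by (intro Min_eqI) (auto intro: rev_image_eqI)
qed

lemma block_min_zero:
  assumes "\<And>q. 0 \<le> x q" "j \<le> d" "x (i, j) = 0"
  shows "block_min i x = 0"
  unfolding block_min_def using assms by (intro Min_eqI) (auto intro: rev_image_eqI)

lemma supp_cell_sum:
  assumes g: "g \<in> realization V K" and i: "i < k" and supp: "{v. g v \<noteq> 0} = \<nu> i ` {..d}"
  shows "(\<Sum>j\<le>d. g (\<nu> i j)) = 1"
proof -
  have "sum g V = sum g (\<nu> i ` {..d})"
    using finV vertex_in[OF i] supp by (intro sum.mono_neutral_right) auto
  also have "\<dots> = (\<Sum>j\<le>d. g (\<nu> i j))"
    using inj[OF i] by (subst sum.reindex) auto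
  finally show ?thesis
    using realizationD(3)[OF g] by simp
qed

lemma spread_in:
  assumes g: "g \<in> realization V K"
  shows "spread g \<in> simplex_boundary_wedge k d"
proof (cases "\<exists>i<k. {v. g v \<noteq> 0} = \<nu> i ` {..d}")
  case True
  then obtain i where i: "i < k" "{v. g v \<noteq> 0} = \<nu> i ` {..d}"
    by blast
  have other: "cell_min i' g = 0" if "i' < k" "i' \<noteq> i" for i'
    using cell_min_zero[OF g that(1)] i that cells_distinct by metis
  have z: "spread g q = (if q \<in> {i} \<times> {..d} then blow d 1 (cell_min i g) (g (\<nu> i (snd q))) else 0)" for q
    using i other by (cases q) (auto simp: spread_def blow_zero)
  note * = blow_simplex[of 1 d "\<lambda>j. g (\<nu> i j)" "cell_min i g"]
  show ?thesis
    unfolding simplex_boundary_wedge_def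
    using i(1) *(1) *(2,3)[OF _ _ _ supp_cell_sum[OF g i] cell_min_def] supp_cell_sum[OF g i] realizationD(1)[OF g]
    by (auto simp: z cell_min_def intro!: bexI[of _ i])
next
  case False
  then have "spread g = (\<lambda>_. 0)"
    using cell_min_zero[OF g] by (auto simp: spread_def blow_zero fun_eq_iff)
  then show ?thesis
    using k by (auto simp: simplex_boundary_wedge_def)
qed

lemma fold_wedge_block:
  assumes i: "i < k" and x: "\<And>q. q \<notin> {i} \<times> {..d} \<Longrightarrow> x q = 0"
  shows "j \<le> d \<Longrightarrow> fold_wedge x (\<nu> i j) = x (i, j)"
    "fold_wedge x p = 1 - (\<Sum>j\<le>d. x (i, j))"
    "v \<noteq> p \<Longrightarrow> v \<notin> \<nu> i ` {..d} \<Longrightarrow> fold_wedge x v = 0"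
proof -
  have s1: "(\<Sum>i'<k. \<Sum>j\<le>d. if \<nu> i' j = v then x (i', j) else 0) = (\<Sum>j\<le>d. if \<nu> i j = v then x (i, j) else 0)" for v
    using i x by (subst sum.mono_neutral_right[of _ "{i}"]) (auto intro!: sum.neutral)
  have s2: "(\<Sum>i'<k. \<Sum>j\<le>d. x (i', j)) = (\<Sum>j\<le>d. x (i, j))"
    using i x by (subst sum.mono_neutral_right[of _ "{i}"]) (auto intro!: sum.neutral)
  show "fold_wedge x (\<nu> i j) = x (i, j)" if "j \<le> d"
    using that apex[OF i that] vertex_sum[OF i that] by (simp add: fold_wedge_def s1)
  show "fold_wedge x p = 1 - (\<Sum>j\<le>d. x (i, j))"
    using apex[OF i] by (simp add: fold_wedge_def s1 s2)
  show "fold_wedge x v = 0" if "v \<noteq> p" "v \<notin> \<nu> i ` {..d}"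
    using that by (auto simp: fold_wedge_def s1 intro!: sum.neutral)
qed

lemma fold_wedge_in:
  assumes "x \<in> simplex_boundary_wedge k d"
  shows "fold_wedge x \<in> realization V K"
proof -
  obtain i where "i < k" "\<And>q. 0 \<le> x q" "\<And>q. q \<notin> {i} \<times> {..d} \<Longrightarrow> x q = 0" "(\<Sum>j\<le>d. x (i, j)) \<le> 1"
    "(\<Sum>j\<le>d. x (i, j)) = 1 \<or> (\<exists>j\<le>d. x (i, j) = 0)"
    using simplex_boundary_wedgeE[OF assms] by metis
  then show ?thesis
    by (intro cell_point[of i "\<lambda>j. x (i, j)"] fold_wedge_block)
qed

text \<open>In an open cell the point moves by \<open>blow\<close> within the simplex boundary of
  \<open>cell_point\<close>. Everywhere else all corrections vanish and the point moves straight to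
  the apex, staying in the complex because its support together with \<open>p\<close> is a face by
  \<open>coned\<close>.\<close>

lemma complex_homotopy_in:
  assumes g: "g \<in> realization V K" and s: "0 \<le> s" "s \<le> 1"
  shows "complex_homotopy s g \<in> realization V K"
proof (cases "\<exists>i<k. {v. g v \<noteq> 0} = \<nu> i ` {..d}")
  case True
  then obtain i where i: "i < k" "{v. g v \<noteq> 0} = \<nu> i ` {..d}"
    by blast
  have other: "cell_min i' g = 0" if "i' < k" "i' \<noteq> i" for i'
    using cell_min_zero[OF g that(1)] i that cells_distinct by metis
  define z where "z j = blow d s (cell_min i g) (g (\<nu> i j))" for j
  note * = blow_simplex[OF s realizationD(1)[OF g] supp_cell_sum[OF g i] cell_min_def, folded z_def]
  have push_eq: "push s g v = (1 - s) * g v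
      + (\<Sum>j\<le>d. if \<nu> i j = v then blow d s (cell_min i g) (g v) - (1 - s) * g v else 0)" for v
    unfolding push_def using i s other
    by (subst sum.mono_neutral_right[of _ "{i}"]) (auto intro!: sum.neutral simp: blow_zero)
  have push_cell: "push s g (\<nu> i j) = z j" if "j \<le> d" for j
    using that vertex_sum[OF i(1)] by (simp add: push_eq z_def)
  have push_out: "push s g v = 0" if "v \<notin> \<nu> i ` {..d}" for v
  proof -
    have "g v = 0" using that i by auto
    then show ?thesis using that by (auto simp: push_eq intro!: sum.neutral)
  qed
  have "sum (push s g) (V - {p}) = sum (push s g) (\<nu> i ` {..d})"
    using finV vertex_in[OF i(1)] apex[OF i(1)] push_out by (intro sum.mono_neutral_right) auto
  also have "\<dots> = (\<Sum>j\<le>d. z j)"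
    using inj[OF i(1)] by (subst sum.reindex) (auto simp: push_cell)
  finally show ?thesis
    using apex[OF i(1)] push_cell push_out
    by (intro cell_point[OF i(1) *]) (auto simp: complex_homotopy_def)
next
  case False
  then have push_eq: "push s g = (\<lambda>v. (1 - s) * g v)"
    using cell_min_zero[OF g] s by (auto simp: push_def blow_zero fun_eq_iff intro!: sum.neutral)
  have "sum g (V - {p}) = 1 - g p"
    using finV pV realizationD(3)[OF g] by (simp add: sum_diff1)
  then have eq: "complex_homotopy s g = (\<lambda>v. if v = p then 1 - (1 - s) * (1 - g p) else (1 - s) * g v)"
    unfolding complex_homotopy_def push_eq by (simp only: sum_distrib_left[symmetric])
  have gp: "g p \<le> 1"
    using realizationD(1,3)[OF g] finV pV member_le_sum[of p V g] by simp
  have "0 \<le> 1 - (1 - s) * (1 - g p)"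
    using s gp realizationD(1)[OF g, of p] mult_le_one[of "1 - s" "1 - g p"] by simp
  moreover have "sum (complex_homotopy s g) V = 1"
  proof -
    have "sum (complex_homotopy s g) V = complex_homotopy s g p + sum (complex_homotopy s g) (V - {p})"
      using finV pV by (rule sum.remove)
    also have "sum (complex_homotopy s g) (V - {p}) = (1 - s) * sum g (V - {p})"
      by (simp add: eq sum_distrib_left)
    finally show ?thesis
      using finV pV realizationD(3)[OF g] by (simp add: eq sum_diff1)
  qed
  moreover have "{v. complex_homotopy s g v \<noteq> 0} \<in> K"
  proof -
    have "insert p {v. g v \<noteq> 0} \<in> K"
      using False by (intro coned realizationD(4)[OF g]) auto
    moreover have "{v. complex_homotopy s g v \<noteq> 0} \<subseteq> insert p {v. g v \<noteq> 0}"
      by (auto simp: eq)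
    ultimately show ?thesis
      using down by blast
  qed
  ultimately show ?thesis
    using realizationD(1,2)[OF g] s pV by (auto simp: realization_def eq)
qed

text \<open>With block sum 1 the point lies in the facet opposite the base point, where
  \<open>blow_simplex\<close> applies; with a zero coordinate the motion is scaling towards the base
  point, which keeps that coordinate 0.\<close>

lemma wedge_homotopy_in:
  assumes x: "x \<in> simplex_boundary_wedge k d" and s: "0 \<le> s" "s \<le> 1"
  shows "wedge_homotopy s x \<in> simplex_boundary_wedge k d"
proof -
  obtain i where i: "i < k" and x: "\<And>q. 0 \<le> x q" "\<And>q. q \<notin> {i} \<times> {..d} \<Longrightarrow> x q = 0" "(\<Sum>j\<le>d. x (i, j)) \<le> 1"
    "(\<Sum>j\<le>d. x (i, j)) = 1 \<or> (\<exists>j\<le>d. x (i, j) = 0)"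
    using simplex_boundary_wedgeE[OF x] by metis
  have "block_min i' x = 0" if "i' \<noteq> i" for i'
    using x(2) that by (intro block_min_zero[OF x(1), of 0]) auto
  then have eq: "wedge_homotopy s x q = (if q \<in> {i} \<times> {..d} then blow d s (block_min i x) (x q) else 0)" for q
    using i x(2) s by (cases q) (auto simp: wedge_homotopy_def blow_zero)
  show ?thesis
  proof (cases "(\<Sum>j\<le>d. x (i, j)) = 1")
    case True
    note * = blow_simplex[OF s x(1) True block_min_def]
    show ?thesis
      unfolding simplex_boundary_wedge_def using i * by (auto simp: eq intro!: bexI[of _ i])
  next
    case False
    then obtain j where j: "j \<le> d" "x (i, j) = 0"
      using x(4) by blast
    then have "block_min i x = 0"
      by (intro block_min_zero[OF x(1)])
    then have eq': "wedge_homotopy s x q = (1 - s) * x q" for q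
      using x(2)[of q] s by (auto simp: eq blow_zero)
    have "(1 - s) * (\<Sum>j\<le>d. x (i, j)) \<le> 1"
      using s x(1,3) by (intro mult_le_one) (auto intro: sum_nonneg)
    then show ?thesis
      unfolding simplex_boundary_wedge_def
      using i s x j by (auto simp: eq' simp flip: sum_distrib_left intro!: bexI[of _ i])
  qed
qed

lemma fold_spread: "fold_wedge (spread g) = complex_homotopy 1 g"
proof -
  have push1: "push 1 g v = (\<Sum>i<k. \<Sum>j\<le>d. if \<nu> i j = v then spread g (i, j) else 0)" for v
    by (auto simp: push_def spread_def intro!: sum.cong)
  have "sum (push 1 g) (V - {p}) = (\<Sum>i<k. \<Sum>j\<le>d. \<Sum>v\<in>V - {p}. if \<nu> i j = v then spread g (i, j) else 0)"
    unfolding push1 by (subst sum.swap) (intro sum.cong refl, subst sum.swap, simp)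
  also have "\<dots> = (\<Sum>i<k. \<Sum>j\<le>d. spread g (i, j))"
    using finV vertex_in apex by (intro sum.cong refl) simp
  finally show ?thesis
    using apex by (auto simp: fold_wedge_def complex_homotopy_def push1 fun_eq_iff intro!: sum.neutral)
qed

text \<open>\<open>spread\<close> reads every cell, and cells may share vertices, so contributions
  to foreign blocks must be excluded. The folded point is supported on cell \<open>i\<close> and
  \<open>p\<close>, so its support is no other cell and all other minima vanish.\<close>

lemma spread_fold:
  assumes xT: "x \<in> simplex_boundary_wedge k d"
  shows "spread (fold_wedge x) = wedge_homotopy 1 x"
proof -
  obtain i where i: "i < k" and x: "\<And>q. 0 \<le> x q" "\<And>q. q \<notin> {i} \<times> {..d} \<Longrightarrow> x q = 0"
    using simplex_boundary_wedgeE[OF xT] by metis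
  have fw1: "fold_wedge x (\<nu> i j) = x (i, j)" if "j \<le> d" for j
    by (rule fold_wedge_block(1)[OF i x(2) that])
  have fw3: "fold_wedge x v = 0" if "v \<noteq> p" "v \<notin> \<nu> i ` {..d}" for v
    by (rule fold_wedge_block(3)[OF i x(2) that])
  have min_i: "cell_min i (fold_wedge x) = block_min i x"
    unfolding cell_min_def block_min_def by (rule arg_cong[of _ _ Min]) (auto simp: fw1)
  have other: "cell_min i' (fold_wedge x) = 0" if i': "i' < k" "i' \<noteq> i" for i'
  proof (rule cell_min_zero[OF fold_wedge_in[OF xT] i'(1)] notI)+
    assume eq: "{v. fold_wedge x v \<noteq> 0} = \<nu> i' ` {..d}"
    have "p \<notin> \<nu> i' ` {..d}"
      using apex[OF i'(1)] by auto
    have "\<nu> i' ` {..d} \<subseteq> \<nu> i ` {..d}"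
    proof
      fix v assume v: "v \<in> \<nu> i' ` {..d}"
      then have "fold_wedge x v \<noteq> 0"
        unfolding eq[symmetric] by simp
      moreover have "v \<noteq> p"
        using v \<open>p \<notin> \<nu> i' ` {..d}\<close> by metis
      ultimately show "v \<in> \<nu> i ` {..d}"
        using fw3 by metis
    qed
    then show False
      using cell_maximal[OF i'(1) cell[OF i]] cells_distinct[OF i i'(1)] i'(2) by blast
  qed
  have otherx: "block_min i' x = 0" if "i' \<noteq> i" for i'
    using x(2) that by (intro block_min_zero[OF x(1), of 0]) auto
  have "spread (fold_wedge x) (i', j) = wedge_homotopy 1 x (i', j)" for i' j
    using other otherx min_i fw1 by (cases "i' = i") (auto simp: spread_def wedge_homotopy_def blow_zero)
  then show ?thesis
    by (auto simp: fun_eq_iff)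
qed

lemma cell_min_nonneg: "g \<in> realization V K \<Longrightarrow> 0 \<le> cell_min i g"
  unfolding cell_min_def using realizationD(1)[of g] by (subst Min_ge_iff) auto

lemma complex_homotopy_start:
  assumes g: "g \<in> realization V K"
  shows "complex_homotopy 0 g = g"
proof -
  have "push 0 g = g"
    using cell_min_nonneg[OF g] by (auto simp: push_def blow_start fun_eq_iff intro!: sum.neutral)
  then show ?thesis
    using finV pV realizationD(3)[OF g] by (auto simp: complex_homotopy_def sum_diff1)
qed

lemma wedge_homotopy_start:
  assumes "x \<in> simplex_boundary_wedge k d"
  shows "wedge_homotopy 0 x = x"
proof -
  obtain i where i: "i < k" and x: "\<And>q. 0 \<le> x q" "\<And>q. q \<notin> {i} \<times> {..d} \<Longrightarrow> x q = 0"
    using simplex_boundary_wedgeE[OF assms] by metis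
  have "0 \<le> block_min i x" for i
    unfolding block_min_def using x(1) by (subst Min_ge_iff) auto
  then show ?thesis
    using x(2) i by (auto simp: wedge_homotopy_def blow_start fun_eq_iff)
qed

section \<open>Continuity of the maps and homotopies\<close>

lemma continuous_on_cell_min: "continuous_on S (\<lambda>z. cell_min i (snd z))"
  unfolding cell_min_def by (intro continuous_on_Min) (auto intro: continuous_on_snd_coordinate)

lemma continuous_on_block_min: "continuous_on S (\<lambda>z. block_min i (snd z))"
  unfolding block_min_def by (intro continuous_on_Min) (auto intro: continuous_on_snd_coordinate)

lemma continuous_on_push: "continuous_on S (\<lambda>z. push (fst z) (snd z) v)"
  unfolding push_def
proof (intro continuous_on_add continuous_on_sum)
  show "continuous_on S (\<lambda>z. (1 - fst z) * snd z v)"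
    by (intro continuous_on_mult continuous_on_diff continuous_on_const continuous_on_fst continuous_on_id
        continuous_on_snd_coordinate)
  show "continuous_on S (\<lambda>z. if \<nu> i j = v then blow d (fst z) (cell_min i (snd z)) (snd z v) - (1 - fst z) * snd z v
             else 0)" for i j
    by (cases "\<nu> i j = v"; simp; intro continuous_on_blow continuous_on_mult continuous_on_diff continuous_on_const
        continuous_on_fst continuous_on_id continuous_on_snd_coordinate continuous_on_cell_min)
qed

lemma continuous_on_complex_homotopy: "continuous_on S (\<lambda>z. complex_homotopy (fst z) (snd z))"
proof (rule continuous_on_coordinatewise_then_product)
  show "continuous_on S (\<lambda>z. complex_homotopy (fst z) (snd z) v)" for v
    unfolding complex_homotopy_def
    by (cases "v = p"; simp; intro continuous_on_diff continuous_on_sum continuous_on_const continuous_on_push)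
qed

lemma continuous_on_wedge_homotopy: "continuous_on S (\<lambda>z. wedge_homotopy (fst z) (snd z))"
proof (rule continuous_on_coordinatewise_then_product)
  show "continuous_on S (\<lambda>z. wedge_homotopy (fst z) (snd z) q)" for q
  proof (cases "fst q < k \<and> snd q \<le> d")
    case True
    then show ?thesis
      by (simp add: wedge_homotopy_def case_prod_beta)
         (intro continuous_on_blow continuous_on_fst continuous_on_id continuous_on_snd_coordinate continuous_on_block_min)
  next
    case False
    then have "(\<lambda>z. wedge_homotopy (fst z) (snd z) q) = (\<lambda>_. 0)"
      by (auto simp: wedge_homotopy_def case_prod_beta)
    then show ?thesis
      by (simp only: continuous_on_const)
  qed
qed

lemma continuous_on_spread: "continuous_on S spread"
proof (rule continuous_on_coordinatewise_then_product)
  have *: "continuous_on S (\<lambda>g. cell_min i g)" for i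
    unfolding cell_min_def by (intro continuous_on_Min) (auto intro: continuous_on_coordinate)
  show "continuous_on S (\<lambda>g. spread g q)" for q
  proof (cases "fst q < k \<and> snd q \<le> d")
    case True
    then show ?thesis
      by (simp add: spread_def case_prod_beta)
         (intro continuous_on_blow continuous_on_const continuous_on_coordinate *)
  next
    case False
    then have "(\<lambda>g. spread g q) = (\<lambda>_. 0)"
      by (auto simp: spread_def case_prod_beta)
    then show ?thesis
      by (simp only: continuous_on_const)
  qed
qed

lemma continuous_on_fold_wedge: "continuous_on S fold_wedge"
proof (rule continuous_on_coordinatewise_then_product)
  have *: "continuous_on S (\<lambda>x. if \<nu> i j = v then x (i, j) else 0 :: real)" for i j v
    by (cases "\<nu> i j = v"; simp; intro continuous_on_const continuous_on_coordinate)
  show "continuous_on S (\<lambda>x. fold_wedge x v)" for v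
    unfolding fold_wedge_def
    by (cases "v = p"; simp; intro * continuous_on_add continuous_on_diff continuous_on_sum continuous_on_const continuous_on_coordinate)
qed

lemma homotopy_eqv_wedge: "realization V K homotopy_eqv simplex_boundary_wedge k d"
proof (rule homotopy_eqvI)
  show "homotopic_with_canon (\<lambda>_. True) (realization V K) (realization V K) id (fold_wedge \<circ> spread)"
    by (rule homotopic_canonI[where h = complex_homotopy])
       (auto simp: continuous_on_complex_homotopy complex_homotopy_in complex_homotopy_start fold_spread)
  show "homotopic_with_canon (\<lambda>_. True) (simplex_boundary_wedge k d) (simplex_boundary_wedge k d) id (spread \<circ> fold_wedge)"
    by (rule homotopic_canonI[where h = wedge_homotopy])
       (auto simp: continuous_on_wedge_homotopy wedge_homotopy_in wedge_homotopy_start spread_fold)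
qed (auto simp: continuous_on_spread continuous_on_fold_wedge spread_in fold_wedge_in)

end

section \<open>Wedges of simplex boundaries and wedges of round spheres\<close>

text \<open>A sphere \<open>(\<Sum>j\<le>d. (y j - \<delta> j 0)\<^sup>2) = 1\<close> is \<open>(\<Sum>j\<le>d. (y j)\<^sup>2) = 2 * y 0\<close>, so each of its points
  other than the origin is determined by its direction, which lies in an open half space.\<close>

definition shift0 :: "(nat \<Rightarrow> real) \<Rightarrow> nat \<Rightarrow> real" where
  "shift0 a j = a j - a 0"

definition coord_sum :: "nat \<Rightarrow> (nat \<Rightarrow> real) \<Rightarrow> real" where
  "coord_sum d a = (\<Sum>j\<le>d. a j)"

definition denom :: "nat \<Rightarrow> (nat \<Rightarrow> real) \<Rightarrow> real" where
  "denom d a = coord_sum d a ^ 4 + (\<Sum>j\<le>d. (shift0 a j)\<^sup>2)"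

text \<open>With S = \<open>coord_sum d a\<close>, the ray in direction u = (S^2, a 1 - a 0, ..., a
  d - a 0) meets the sphere at 2 u_0 / |u|^2 times u, and |u|^2 is \<open>denom\<close>. Along a
  segment from the base point the differences are proportional to S, so the slopes (a j - a 0) / S^2
  grow without bound as S tends to 0; with S in place of S^2 they would be constant and injectivity
  would fail.\<close>

definition to_sphere :: "nat \<Rightarrow> (nat \<Rightarrow> real) \<Rightarrow> nat \<Rightarrow> real" where
  "to_sphere d a j =
     (if j \<le> d then 2 * (coord_sum d a)\<^sup>2 * (if j = 0 then (coord_sum d a)\<^sup>2 else shift0 a j) / denom d a else 0)"

definition in_boundary :: "nat \<Rightarrow> (nat \<Rightarrow> real) \<Rightarrow> bool" where
  "in_boundary d a \<longleftrightarrow> (\<forall>j\<le>d. 0 \<le> a j) \<and> coord_sum d a \<le> 1 \<and> (coord_sum d a = 1 \<or> (\<exists>j\<le>d. a j = 0))"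

text \<open>Inverse of \<open>to_sphere\<close>: the ratios \<open>b j / b 0\<close> determine \<open>a j - a 0\<close> up to the factor \<open>(\<Sum>j\<le>d. a j)\<^sup>2\<close>,
  and \<open>b 0 / M\<close> recovers \<open>\<Sum>j\<le>d. a j\<close>.\<close>

definition from_sphere :: "nat \<Rightarrow> (nat \<Rightarrow> real) \<Rightarrow> nat \<Rightarrow> real" where
  "from_sphere d b j =
     (let b' = b(0 := 0); m = Min (b' ` {..d}); A = (\<Sum>j\<le>d. b' j - m); M = max (b 0) A
      in b 0 * (b' j - m) / M\<^sup>2 + (b 0 / M - A * b 0 / M\<^sup>2) / real (Suc d))"

lemma sphere_iff:
  "(\<Sum>j\<le>d. (y j - (if j = 0 then 1 else 0))\<^sup>2) = (1::real) \<longleftrightarrow> (\<Sum>j\<le>d. (y j)\<^sup>2) = 2 * y (0::nat)"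
proof -
  have "(\<Sum>j\<le>d. (y j - (if j = 0 then 1 else 0))\<^sup>2) = (\<Sum>j\<le>d. (y j)\<^sup>2 + (if j = 0 then 1 - 2 * y 0 else 0))"
    by (intro sum.cong) (auto simp: power2_eq_square algebra_simps)
  also have "\<dots> = (\<Sum>j\<le>d. (y j)\<^sup>2) + (1 - 2 * y 0)"
    by (simp add: sum.distrib)
  finally show ?thesis
    by auto
qed

lemma denom_pos: "coord_sum d a \<noteq> 0 \<Longrightarrow> 0 < denom d a"
  unfolding denom_def by (intro add_pos_nonneg sum_nonneg) auto

lemma to_sphere_sumsq: "(\<Sum>j\<le>d. (to_sphere d a j)\<^sup>2) = 2 * to_sphere d a 0"
proof (cases "coord_sum d a = 0")
  case True
  then show ?thesis by (simp add: to_sphere_def)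
next
  case False
  define c where "c = 2 * (coord_sum d a)\<^sup>2 / denom d a"
  have D: "0 < denom d a"
    using denom_pos[OF False] .
  have "(\<Sum>j\<le>d. (to_sphere d a j)\<^sup>2) = (\<Sum>j\<le>d. c\<^sup>2 * ((if j = 0 then coord_sum d a ^ 4 else 0) + (shift0 a j)\<^sup>2))"
    by (intro sum.cong) (auto simp: to_sphere_def c_def shift0_def power_divide power_mult_distrib)
  also have "\<dots> = c\<^sup>2 * denom d a"
    by (simp add: denom_def sum.distrib flip: sum_distrib_left)
  also have "\<dots> = 2 * to_sphere d a 0"
    using D by (simp add: to_sphere_def c_def power2_eq_square field_simps)
  finally show ?thesis .
qed

text \<open>Controls the quotient in \<open>to_sphere\<close> near the base point, where numerator
  and denominator both vanish. If the coordinate sum S is 1, \<open>denom\<close> is at least 1.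
  Otherwise some \<open>a l\<close> is 0, so every \<open>a j\<close> is a difference of two shifts,
  which bounds S by a multiple of the root of \<open>denom\<close>.\<close>

lemma coord_sum_le_denom:
  assumes "in_boundary d a"
  shows "coord_sum d a ^ 4 \<le> (4 * (real (Suc d))\<^sup>2 * (coord_sum d a)\<^sup>2) * denom d a"
proof (cases "coord_sum d a = 1")
  case True
  have "1 \<le> denom d a"
    unfolding denom_def by (simp add: True sum_nonneg)
  moreover have "1 \<le> 4 * (real (Suc d))\<^sup>2"
    using one_le_power[of "real (Suc d)" 2] by linarith
  ultimately show ?thesis
    using mult_mono[of 1 "4 * (real (Suc d))\<^sup>2" 1 "denom d a"] True by simp
next
  case False
  then obtain l where l: "l \<le> d" "a l = 0"
    using assms by (auto simp: in_boundary_def)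
  define Q where "Q = (\<Sum>j\<le>d. (shift0 a j)\<^sup>2)"
  have Q0: "0 \<le> Q" by (simp add: Q_def sum_nonneg)
  have le: "\<bar>shift0 a j\<bar> \<le> sqrt Q" if "j \<le> d" for j
    unfolding Q_def using that by (intro real_le_rsqrt) (auto intro!: member_le_sum)
  have "coord_sum d a = (\<Sum>j\<le>d. shift0 a j - shift0 a l)"
    by (simp add: coord_sum_def shift0_def l)
  also have "\<dots> \<le> (\<Sum>j\<le>d. 2 * sqrt Q)"
  proof (rule sum_mono)
    fix j assume "j \<in> {..d}"
    then show "shift0 a j - shift0 a l \<le> 2 * sqrt Q"
      using le[of j] le[OF l(1)] by auto
  qed
  finally have "coord_sum d a \<le> 2 * real (Suc d) * sqrt Q"
    by (simp add: mult_ac del: of_nat_Suc)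
  moreover have "0 \<le> coord_sum d a"
    using assms by (auto simp: coord_sum_def in_boundary_def intro!: sum_nonneg)
  ultimately have "(coord_sum d a)\<^sup>2 \<le> (2 * real (Suc d) * sqrt Q)\<^sup>2"
    by (intro power_mono)
  also have "\<dots> = 4 * (real (Suc d))\<^sup>2 * Q"
    using Q0 by (simp add: power_mult_distrib del: of_nat_Suc)
  also have "\<dots> \<le> 4 * (real (Suc d))\<^sup>2 * denom d a"
    by (intro mult_left_mono) (auto simp: denom_def Q_def)
  finally have "(coord_sum d a)\<^sup>2 * (coord_sum d a)\<^sup>2 \<le> (coord_sum d a)\<^sup>2 * (4 * (real (Suc d))\<^sup>2 * denom d a)"
    by (intro mult_left_mono) auto
  then show ?thesis
    by (simp add: power4_eq_xxxx power2_eq_square mult_ac)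
qed

text \<open>The previous estimate bounds coordinate 0 by 8 (d + 1)^2 S^2, with S the coordinate sum.
  On the sphere every squared coordinate is at most twice coordinate 0, and the constant is the root
  of 16 (d + 1)^2.\<close>

lemma to_sphere_bound:
  assumes "in_boundary d a"
  shows "\<bar>to_sphere d a j\<bar> \<le> 4 * real (Suc d) * coord_sum d a"
proof -
  have S0: "0 \<le> coord_sum d a"
    using assms by (auto simp: coord_sum_def in_boundary_def intro!: sum_nonneg)
  have "to_sphere d a 0 \<le> 8 * (real (Suc d))\<^sup>2 * (coord_sum d a)\<^sup>2"
  proof (cases "coord_sum d a = 0")
    case False
    then have "to_sphere d a 0 = 2 * (coord_sum d a ^ 4 / denom d a)"
      by (simp add: to_sphere_def power4_eq_xxxx power2_eq_square)
    also have "\<dots> \<le> 2 * (4 * (real (Suc d))\<^sup>2 * (coord_sum d a)\<^sup>2)"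
      using coord_sum_le_denom[OF assms] denom_pos[OF False] by (intro mult_left_mono) (auto simp: pos_divide_le_eq)
    finally show ?thesis by simp
  qed (simp add: to_sphere_def)
  moreover have "(to_sphere d a j)\<^sup>2 \<le> 2 * to_sphere d a 0"
  proof (cases "j \<le> d")
    case True
    then show ?thesis
      unfolding to_sphere_sumsq[symmetric] by (intro member_le_sum) auto
  qed (use to_sphere_sumsq[of d a, symmetric] in \<open>auto simp: to_sphere_def sum_nonneg\<close>)
  moreover have "(4 * real (Suc d) * coord_sum d a)\<^sup>2 = 16 * (real (Suc d))\<^sup>2 * (coord_sum d a)\<^sup>2"
    by (simp add: power_mult_distrib del: of_nat_Suc)
  ultimately have "(to_sphere d a j)\<^sup>2 \<le> (4 * real (Suc d) * coord_sum d a)\<^sup>2"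
    by linarith
  then show ?thesis
    using S0 by (intro power2_le_imp_le[of "\<bar>_\<bar>"]) auto
qed

lemma from_to_sphere:
  assumes a: "in_boundary d a" and j: "j \<le> d"
  shows "from_sphere d (to_sphere d a) j = a j"
proof (cases "coord_sum d a = 0")
  case True
  then have "to_sphere d a = (\<lambda>_. 0)"
    by (auto simp: to_sphere_def fun_eq_iff)
  moreover have "a j = 0"
    using True a j by (intro sum_nonneg_0[of "{..d}" a]) (auto simp: coord_sum_def in_boundary_def)
  ultimately show ?thesis
    by (simp add: from_sphere_def Let_def)
next
  case False
  define S where "S = coord_sum d a"
  \<comment> \<open>The factor between the direction vector and its point on the sphere. It cancels
    at the end, because \<open>from_sphere\<close> is unchanged when its argument is scaled by a
    positive number.\<close>
  define c where "c = 2 * S\<^sup>2 / denom d a"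
  define \<mu> where "\<mu> = Min (a ` {..d})"
  have "0 \<le> S"
    using a by (auto simp: S_def coord_sum_def in_boundary_def intro!: sum_nonneg)
  then have S: "0 < S"
    using False by (simp add: S_def)
  have c: "0 < c"
    using S denom_pos[OF False] by (simp add: c_def)
  let ?b = "to_sphere d a" and ?b' = "(to_sphere d a)(0 := 0)"
  have b0: "?b 0 = c * S\<^sup>2"
    by (simp add: to_sphere_def c_def S_def power2_eq_square)
  have b': "?b' j = c * (a j - a 0)" if "j \<le> d" for j
    using that by (auto simp: to_sphere_def c_def S_def shift0_def)
  have \<mu>_in: "\<mu> \<in> a ` {..d}"
    unfolding \<mu>_def by (rule Min_in) auto
  have \<mu>_le: "\<mu> \<le> a j" if "j \<le> d" for j
    unfolding \<mu>_def using that by (intro Min_le) auto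
  have m: "Min (?b' ` {..d}) = c * (\<mu> - a 0)"
  proof (rule Min_eqI)
    show "c * (\<mu> - a 0) \<in> ?b' ` {..d}"
      using \<mu>_in b' by force
    show "c * (\<mu> - a 0) \<le> y" if y: "y \<in> ?b' ` {..d}" for y
    proof -
      obtain j where j: "j \<le> d" "y = ?b' j"
        using y by blast
      then have "y = c * (a j - a 0)"
        by (simp only: b')
      then show ?thesis
        using \<mu>_le[OF j(1)] c by simp
    qed
  qed simp
  have diff: "?b' j - c * (\<mu> - a 0) = c * (a j - \<mu>)" if "j \<le> d" for j
    using b'[OF that] by (simp add: algebra_simps)
  have A: "(\<Sum>j\<le>d. ?b' j - c * (\<mu> - a 0)) = c * (S - real (Suc d) * \<mu>)"
  proof -
    have "(\<Sum>j\<le>d. ?b' j - c * (\<mu> - a 0)) = (\<Sum>j\<le>d. c * (a j - \<mu>))"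
      using diff by (intro sum.cong) auto
    then show ?thesis
      by (simp add: S_def coord_sum_def sum_subtractf flip: sum_distrib_left)
  qed
  \<comment> \<open>On the facet S = 1 the first entry is 1 and dominates as \<mu> \<ge> 0;
    elsewhere \<mu> = 0 and S^2 \<le> S. This is the reason for the maximum \<open>M\<close> in
    \<open>from_sphere\<close>.\<close>
  have "max (S\<^sup>2) (S - real (Suc d) * \<mu>) = S"
  proof (cases "S = 1")
    case True
    then show ?thesis
      using a \<mu>_in by (auto simp: in_boundary_def)
  next
    case False
    then obtain l where l: "l \<le> d" "a l = 0" and "S \<le> 1"
      using a by (auto simp: in_boundary_def S_def)
    then have "\<mu> = 0"
      using \<mu>_le[OF l(1)] \<mu>_in a by (auto simp: in_boundary_def)
    then show ?thesis
      using S \<open>S \<le> 1\<close> by (simp add: power2_eq_square mult_left_le)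
  qed
  then have M: "max (c * S\<^sup>2) (c * (S - real (Suc d) * \<mu>)) = c * S"
    using c max_mult_distrib_left[of c "S\<^sup>2" "S - real (Suc d) * \<mu>"] by simp
  have "from_sphere d ?b j = c * S\<^sup>2 * (c * (a j - \<mu>)) / (c * S)\<^sup>2
      + (c * S\<^sup>2 / (c * S) - c * (S - real (Suc d) * \<mu>) * (c * S\<^sup>2) / (c * S)\<^sup>2) / real (Suc d)"
    unfolding from_sphere_def Let_def m A M diff[OF j] b0 ..
  also have "c * S\<^sup>2 * (c * (a j - \<mu>)) / (c * S)\<^sup>2 = a j - \<mu>"
    using c S by (simp add: power2_eq_square)
  also have "c * S\<^sup>2 / (c * S) = S"
    using c S by (simp add: power2_eq_square)
  also have "c * (S - real (Suc d) * \<mu>) * (c * S\<^sup>2) / (c * S)\<^sup>2 = S - real (Suc d) * \<mu>"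
    using c S by (simp add: power2_eq_square)
  finally show ?thesis
    by simp
qed

text \<open>For \<open>b 0\<close> positive, the constructed point has squared coordinate sum
  \<open>e * b 0\<close> and shifts \<open>e * b j\<close> for j > 0, so its direction vector is a
  positive multiple of \<open>b\<close>, and a ray in the open half space meets the sphere only once
  away from the origin. If \<open>M\<close> is \<open>b 0\<close>, the sum is 1; if \<open>M\<close>
  is \<open>A\<close>, the common summand \<open>r\<close> vanishes and so does the smallest
  coordinate.\<close>

lemma
  assumes b: "(\<Sum>j\<le>d. (b j)\<^sup>2) = 2 * b 0"
  shows from_sphere_boundary: "in_boundary d (from_sphere d b)"
    and to_from_sphere: "j \<le> d \<Longrightarrow> to_sphere d (from_sphere d b) j = b j"
proof -
  have "0 \<le> (\<Sum>j\<le>d. (b j)\<^sup>2)"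
    by (simp add: sum_nonneg)
  then have b0: "0 \<le> b 0"
    using b by simp
  have "in_boundary d (from_sphere d b) \<and> (\<forall>j\<le>d. to_sphere d (from_sphere d b) j = b j)"
  proof (cases "b 0 = 0")
    case True
    then have zero: "b j = 0" if "j \<le> d" for j
      using b that by (simp add: sum_nonneg_eq_0_iff)
    have "from_sphere d b = (\<lambda>_. 0)"
      by (auto simp: from_sphere_def Let_def True fun_eq_iff)
    then show ?thesis
      using zero by (auto simp: in_boundary_def coord_sum_def to_sphere_def)
  next
    case False
    define b' where "b' = b(0 := 0)"
    define m where "m = Min (b' ` {..d})"
    define A where "A = (\<Sum>j\<le>d. b' j - m)"
    define M where "M = max (b 0) A"
    define r where "r = (b 0 / M - A * b 0 / M\<^sup>2) / real (Suc d)"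
    define t where "t = from_sphere d b"
    define e where "e = b 0 / M\<^sup>2"
    have b0: "0 < b 0"
      using b0 False by simp
    then have M: "0 < M" "b 0 \<le> M" "A \<le> M"
      by (auto simp: M_def)
    have e: "0 < e"
      using b0 M by (simp add: e_def)
    have t: "t j = e * (b' j - m) + r" for j
      by (simp add: t_def from_sphere_def Let_def b'_def m_def A_def M_def r_def e_def)
    have m_le: "m \<le> b' j" if "j \<le> d" for j
      unfolding m_def using that by (intro Min_le) auto
    have "m \<in> b' ` {..d}"
      unfolding m_def by (rule Min_in) auto
    then obtain l where l: "l \<le> d" "b' l = m"
      by auto
    have r_eq: "r = e * (M - A) / real (Suc d)"
      using M by (simp add: r_def e_def field_simps power2_eq_square)
    then have r: "0 \<le> r"
      using e M by simp
    have sum_t: "coord_sum d t = b 0 / M"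
    proof -
      have "coord_sum d t = e * A + real (Suc d) * r"
        by (simp add: coord_sum_def t A_def sum.distrib flip: sum_distrib_left)
      also have "real (Suc d) * r = e * (M - A)"
        by (simp add: r_eq del: of_nat_Suc)
      also have "e * A + e * (M - A) = e * M"
        by (simp add: algebra_simps)
      finally show ?thesis
        using M by (simp add: e_def power2_eq_square)
    qed
    have bd: "in_boundary d t"
      unfolding in_boundary_def
    proof (intro conjI allI impI)
      show "0 \<le> t j" if "j \<le> d" for j
        using m_le[OF that] e r by (simp add: t)
      show "coord_sum d t \<le> 1"
        using M by (simp add: sum_t)
      show "coord_sum d t = 1 \<or> (\<exists>j\<le>d. t j = 0)"
      proof (cases "A \<le> b 0")
        case True
        then show ?thesis using M b0 by (simp add: sum_t M_def)
      next
        case False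
        then have "M = A"
          by (simp add: M_def)
        then have "t l = 0"
          by (simp add: t l r_eq)
        then show ?thesis using l by blast
      qed
    qed
    have w: "shift0 t j = e * b' j" for j
      by (simp add: shift0_def t b'_def algebra_simps)
    have tot2: "(coord_sum d t)\<^sup>2 = e * b 0"
      using M by (simp add: sum_t e_def power2_eq_square)
    have "denom d t = e\<^sup>2 * ((b 0)\<^sup>2 + (\<Sum>j\<le>d. (b' j)\<^sup>2))"
    proof -
      have "coord_sum d t ^ 4 = ((coord_sum d t)\<^sup>2)\<^sup>2"
        by simp
      then show ?thesis
        unfolding denom_def w tot2 by (simp add: power_mult_distrib distrib_left sum_distrib_left)
    qed
    also have "(b 0)\<^sup>2 + (\<Sum>j\<le>d. (b' j)\<^sup>2) = (\<Sum>j\<le>d. (b j)\<^sup>2)"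
    proof -
      have "(\<Sum>j\<le>d. (b j)\<^sup>2) = (\<Sum>j\<le>d. (if j = 0 then (b 0)\<^sup>2 else 0) + (b' j)\<^sup>2)"
        by (intro sum.cong) (auto simp: b'_def)
      then show ?thesis
        by (simp add: sum.distrib)
    qed
    finally have D: "denom d t = e\<^sup>2 * (2 * b 0)"
      by (simp add: b)
    have "to_sphere d t j = b j" if "j \<le> d" for j
      unfolding to_sphere_def D tot2 w using that e b0
      by (auto simp: b'_def field_simps power2_eq_square)
    then show ?thesis
      using bd by (simp add: t_def)
  qed
  then show "in_boundary d (from_sphere d b)" "j \<le> d \<Longrightarrow> to_sphere d (from_sphere d b) j = b j"
    by auto
qed

definition wedge_map :: "nat \<Rightarrow> nat \<Rightarrow> (nat \<times> nat \<Rightarrow> real) \<Rightarrow> nat \<times> nat \<Rightarrow> real" where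
  "wedge_map k d x = (\<lambda>(i, j). if i < k then to_sphere d (\<lambda>j. x (i, j)) j else 0)"

lemma to_sphere_zero: "to_sphere d (\<lambda>_. 0) j = 0"
  by (simp add: to_sphere_def coord_sum_def)

lemma boundary_wedge_block:
  assumes "x \<in> simplex_boundary_wedge k d"
  shows "in_boundary d (\<lambda>j. x (i, j))"
proof -
  obtain i' where x: "\<And>q. 0 \<le> x q" "\<And>q. q \<notin> {i'} \<times> {..d} \<Longrightarrow> x q = 0" "(\<Sum>j\<le>d. x (i', j)) \<le> 1"
    "(\<Sum>j\<le>d. x (i', j)) = 1 \<or> (\<exists>j\<le>d. x (i', j) = 0)"
    using simplex_boundary_wedgeE[OF assms] by metis
  show ?thesis
  proof (cases "i' = i")
    case True
    then show ?thesis using x by (simp add: in_boundary_def coord_sum_def)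
  next
    case False
    then have "(\<lambda>j. x (i, j)) = (\<lambda>_. 0)"
      using x(2) by (auto simp: fun_eq_iff)
    then show ?thesis by (auto simp: in_boundary_def coord_sum_def)
  qed
qed

lemma wedge_map_in:
  assumes x: "x \<in> simplex_boundary_wedge k d"
  shows "wedge_map k d x \<in> wedge_spheres_set k d"
proof -
  obtain i where i: "i < k" and x0: "\<And>q. q \<notin> {i} \<times> {..d} \<Longrightarrow> x q = 0"
    using simplex_boundary_wedgeE[OF x] by metis
  have "wedge_map k d x (i', j) = 0" if "(i', j) \<notin> {i} \<times> {..d}" for i' j
  proof (cases "i' = i")
    case False
    then have "(\<lambda>j. x (i', j)) = (\<lambda>_. 0)"
      using x0 by (auto simp: fun_eq_iff)
    then show ?thesis by (simp add: wedge_map_def to_sphere_zero)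
  qed (use that in \<open>auto simp: wedge_map_def to_sphere_def\<close>)
  moreover have "(\<Sum>j\<le>d. (wedge_map k d x (i, j) - (if j = 0 then 1 else 0))\<^sup>2) = 1"
    using i by (simp add: sphere_iff wedge_map_def to_sphere_sumsq)
  ultimately show ?thesis
    unfolding wedge_spheres_set_def using i by auto
qed

lemma inj_on_wedge_map: "inj_on (wedge_map k d) (simplex_boundary_wedge k d)"
proof (rule inj_onI)
  fix x x' assume x: "x \<in> simplex_boundary_wedge k d" "x' \<in> simplex_boundary_wedge k d"
    and eq: "wedge_map k d x = wedge_map k d x'"
  show "x = x'"
  proof
    fix q :: "nat \<times> nat"
    obtain i j where q: "q = (i, j)" by force
    show "x q = x' q"
    proof (cases "i < k \<and> j \<le> d")
      case True
      have *: "to_sphere d (\<lambda>j. x (i, j)) = (\<lambda>j. wedge_map k d x (i, j))" for x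
        using True by (simp add: wedge_map_def fun_eq_iff)
      have "from_sphere d (to_sphere d (\<lambda>j. x (i, j))) j = from_sphere d (to_sphere d (\<lambda>j. x' (i, j))) j"
        unfolding * eq ..
      then show ?thesis
        using True from_to_sphere[OF boundary_wedge_block] x q by simp
    next
      case False
      then have zero: "x (i, j) = 0" if "x \<in> simplex_boundary_wedge k d" for x
        using that by (elim simplex_boundary_wedgeE) auto
      then show ?thesis using zero[OF x(1)] zero[OF x(2)] q by simp
    qed
  qed
qed

lemma wedge_map_surj: "wedge_spheres_set k d \<subseteq> wedge_map k d ` simplex_boundary_wedge k d"
proof
  fix y assume "y \<in> wedge_spheres_set k d"
  then obtain i where i: "i < k" and y0: "\<And>q. q \<notin> {i} \<times> {..d} \<Longrightarrow> y q = 0"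
    and ysum: "(\<Sum>j\<le>d. (y (i, j))\<^sup>2) = 2 * y (i, 0)"
    unfolding wedge_spheres_set_def sphere_iff by auto
  define t where "t = from_sphere d (\<lambda>j. y (i, j))"
  have t: "in_boundary d t" "\<And>j. j \<le> d \<Longrightarrow> to_sphere d t j = y (i, j)"
    unfolding t_def using from_sphere_boundary[OF ysum] to_from_sphere[OF ysum] by auto
  define x where "x q = (if q \<in> {i} \<times> {..d} then t (snd q) else 0)" for q
  have "x \<in> simplex_boundary_wedge k d"
    using t(1) by (intro simplex_boundary_wedgeI[OF i]) (auto simp: x_def in_boundary_def coord_sum_def)
  moreover have "wedge_map k d x = y"
  proof
    fix q :: "nat \<times> nat"
    obtain i' j where q: "q = (i', j)" by force
    show "wedge_map k d x q = y q"
    proof (cases "i' = i \<and> j \<le> d")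
      case True
      have "to_sphere d (\<lambda>j. x (i, j)) j = to_sphere d t j"
        using True by (simp add: to_sphere_def coord_sum_def denom_def shift0_def x_def)
      then show ?thesis
        using True i t(2) by (simp add: q wedge_map_def)
    next
      case False
      then show ?thesis
        using y0[of q] by (auto simp: q wedge_map_def x_def to_sphere_def coord_sum_def)
    qed
  qed
  ultimately show "y \<in> wedge_map k d ` simplex_boundary_wedge k d"
    by blast
qed

lemma continuous_on_wedge_map: "continuous_on (simplex_boundary_wedge k d) (wedge_map k d)"
proof (rule continuous_on_coordinatewise_then_product)
  fix q :: "nat \<times> nat"
  obtain i j where q: "q = (i, j)" by force
  let ?T = "simplex_boundary_wedge k d" and ?F = "\<lambda>x. to_sphere d (\<lambda>j. x (i, j)) j"
  let ?S = "\<lambda>x. coord_sum d (\<lambda>j. x (i, j))" and ?D = "\<lambda>x. denom d (\<lambda>j. x (i, j))"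
  have S: "continuous_on ?T ?S"
    unfolding coord_sum_def by (intro continuous_on_sum continuous_on_coordinate)
  have D: "continuous_on ?T ?D"
    unfolding denom_def shift0_def
    by (intro continuous_on_sum continuous_on_coordinate continuous_on_power continuous_on_add continuous_on_diff S)
  have num: "continuous_on ?T (\<lambda>x. 2 * (?S x)\<^sup>2 * (if j = 0 then (?S x)\<^sup>2 else shift0 (\<lambda>j. x (i, j)) j))"
    by (cases "j = 0"; simp add: shift0_def; intro S continuous_on_mult continuous_on_power continuous_on_const
        continuous_on_diff continuous_on_coordinate)
  have "continuous_on ?T ?F" if j: "j \<le> d"
    unfolding continuous_on_def
  proof
    fix x assume x: "x \<in> ?T"
    show "(?F \<longlongrightarrow> ?F x) (at x within ?T)"
    \<comment> \<open>At the base point of the block the quotient is 0 / 0, so the limit comes from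
      \<open>to_sphere_bound\<close> by comparison. Elsewhere the denominator is nonzero.\<close>
    proof (cases "?S x = 0")
      case True
      then have Fx: "?F x = 0"
        by (simp add: to_sphere_def)
      have "((\<lambda>x. 4 * real (Suc d) * ?S x) \<longlongrightarrow> 4 * real (Suc d) * ?S x) (at x within ?T)"
        using S x by (intro tendsto_mult tendsto_const) (auto simp: continuous_on_def)
      then have lim: "((\<lambda>x. 4 * real (Suc d) * ?S x) \<longlongrightarrow> 0) (at x within ?T)"
        by (simp add: True)
      have "eventually (\<lambda>x. norm (?F x) \<le> 4 * real (Suc d) * ?S x) (at x within ?T)"
        unfolding eventually_at_topological real_norm_def
        by (intro exI[of _ UNIV] conjI) (auto intro!: to_sphere_bound boundary_wedge_block simp del: of_nat_Suc)
      then show ?thesis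
        unfolding Fx using lim by (rule Lim_null_comparison)
    next
      case False
      then have "?D x \<noteq> 0"
        using denom_pos by force
      then have "((\<lambda>x. 2 * (?S x)\<^sup>2 * (if j = 0 then (?S x)\<^sup>2 else shift0 (\<lambda>j. x (i, j)) j) / ?D x) \<longlongrightarrow>
             2 * (?S x)\<^sup>2 * (if j = 0 then (?S x)\<^sup>2 else shift0 (\<lambda>j. x (i, j)) j) / ?D x) (at x within ?T)"
        using num D x by (intro tendsto_divide) (auto simp only: continuous_on_def)
      then show ?thesis
        using j by (simp only: to_sphere_def if_True)
    qed
  qed
  then show "continuous_on ?T (\<lambda>x. wedge_map k d x q)"
    by (cases "i < k"; cases "j \<le> d") (simp_all add: q wedge_map_def to_sphere_def[of d _ j])
qed

text \<open>A continuous bijection from a compact space onto a Hausdorff space is a homeomorphism,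
  which spares a continuity proof for \<open>from_sphere\<close>. The index set is infinite, so
  compactness of the surrounding cube is Tychonoff's theorem.\<close>

lemma compact_simplex_boundary_wedge: "compact (simplex_boundary_wedge k d)"
proof -
  let ?B = "PiE UNIV (\<lambda>_. {0..1}) :: (nat \<times> nat \<Rightarrow> real) set"
  have "compactin (powertop_real UNIV) ?B"
    by (simp add: compactin_PiE)
  then have B: "compact ?B"
    by (simp add: euclidean_product_topology)
  have "closed (simplex_boundary_wedge k d)"
    unfolding simplex_boundary_wedge_def
  proof (intro closed_UN ballI closed_Collect_conj closed_Collect_all closed_Collect_disj)
    fix i
    show "closed {x :: nat \<times> nat \<Rightarrow> real. 0 \<le> x q}" for q
      by (intro closed_Collect_le continuous_on_const continuous_on_coordinate)
    show "closed {x :: nat \<times> nat \<Rightarrow> real. q \<notin> {i} \<times> {..d} \<longrightarrow> x q = 0}" for q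
      by (cases "q \<in> {i} \<times> {..d}") (auto intro!: closed_Collect_eq continuous_on_const continuous_on_coordinate)
    show "closed {x :: nat \<times> nat \<Rightarrow> real. (\<Sum>j\<le>d. x (i, j)) \<le> 1}"
      by (intro closed_Collect_le continuous_on_const continuous_on_sum continuous_on_coordinate)
    show "closed {x :: nat \<times> nat \<Rightarrow> real. (\<Sum>j\<le>d. x (i, j)) = 1}"
      by (intro closed_Collect_eq continuous_on_const continuous_on_sum continuous_on_coordinate)
    have "{x :: nat \<times> nat \<Rightarrow> real. \<exists>j\<le>d. x (i, j) = 0} = (\<Union>j\<in>{..d}. {x. x (i, j) = 0})"
      by auto
    also have "closed \<dots>"
      by (intro closed_UN ballI closed_Collect_eq continuous_on_const continuous_on_coordinate) auto
    finally show "closed {x :: nat \<times> nat \<Rightarrow> real. \<exists>j\<le>d. x (i, j) = 0}" .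
  qed auto
  moreover have "simplex_boundary_wedge k d \<subseteq> ?B"
  proof
    fix x assume "x \<in> simplex_boundary_wedge k d"
    then obtain i where x: "\<And>q. 0 \<le> x q" "\<And>q. q \<notin> {i} \<times> {..d} \<Longrightarrow> x q = 0" "(\<Sum>j\<le>d. x (i, j)) \<le> 1"
      using simplex_boundary_wedgeE by metis
    have "x q \<le> 1" for q
    proof (cases "q \<in> {i} \<times> {..d}")
      case True
      then have "x q \<le> (\<Sum>j\<le>d. x (i, j))"
        using x(1) member_le_sum[of "snd q" "{..d}" "\<lambda>j. x (i, j)"] by auto
      then show ?thesis using x(3) by simp
    qed (simp add: x(2))
    then show "x \<in> ?B"
      using x(1) by auto
  qed
  ultimately show ?thesis
    using compact_Int_closed[OF B] by (metis Int_absorb1)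
qed

lemma simplex_boundary_wedge_homotopy_eqv:
  "simplex_boundary_wedge k d homotopy_eqv wedge_spheres_set k d"
proof (rule homeomorphic_imp_homotopy_equivalent_space)
  have "homeomorphic_map (top_of_set (simplex_boundary_wedge k d)) (top_of_set (wedge_spheres_set k d)) (wedge_map k d)"
  proof (rule continuous_imp_homeomorphic_map)
    show "continuous_map (top_of_set (simplex_boundary_wedge k d)) (top_of_set (wedge_spheres_set k d)) (wedge_map k d)"
      using continuous_on_wedge_map wedge_map_in by auto
    show "compact_space (top_of_set (simplex_boundary_wedge k d))"
      using compact_simplex_boundary_wedge by (simp add: compact_space_subtopology)
    have "Hausdorff_space (powertop_real UNIV :: (nat \<times> nat \<Rightarrow> real) topology)"
      by (simp add: Hausdorff_space_product_topology)
    then show "Hausdorff_space (top_of_set (wedge_spheres_set k d))"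
      by (simp add: euclidean_product_topology Hausdorff_space_subtopology)
    show "wedge_map k d ` topspace (top_of_set (simplex_boundary_wedge k d)) = topspace (top_of_set (wedge_spheres_set k d))"
      by (simp add: set_eq_subset image_subset_iff wedge_map_in wedge_map_surj)
  qed (simp add: inj_on_wedge_map)
  then show "top_of_set (simplex_boundary_wedge k d) homeomorphic_space top_of_set (wedge_spheres_set k d)"
    by (rule homeomorphic_map_imp_homeomorphic_space)
qed

section \<open>Complexes given by forbidden faces\<close>

text \<open>In terms of nonfaces, removing the open star of \<sigma> is adding \<sigma> to
  \<open>F\<close>, so a sequence of collapses is a growing family.\<close>

definition avoid :: "'a set \<Rightarrow> 'a set set \<Rightarrow> 'a set set" where
  "avoid V F = {\<tau>. \<tau> \<subseteq> V \<and> (\<forall>\<phi>\<in>F. \<not> \<phi> \<subseteq> \<tau>)}"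

lemma avoid_subset: "\<tau> \<in> avoid V F \<Longrightarrow> \<tau>' \<subseteq> \<tau> \<Longrightarrow> \<tau>' \<in> avoid V F"
  unfolding avoid_def by blast

text \<open>The last hypothesis makes the link of \<sigma> a cone with apex \<open>w\<close>: if
  adding \<open>w\<close> to a face above \<sigma> completed a forbidden \<phi>, the face would
  already contain the forbidden \<phi>'.\<close>

lemma collapse_avoid:
  assumes "finite V" "\<sigma> \<subseteq> V" "\<sigma> \<noteq> {}" "w \<in> V" "w \<notin> \<sigma>"
    and cone: "\<forall>\<phi>\<in>F. w \<in> \<phi> \<longrightarrow> (\<exists>\<phi>'\<in>F. \<phi>' \<subseteq> \<sigma> \<union> (\<phi> - {w}))"
  shows "realization V (avoid V F) homotopy_eqv realization V (avoid V (insert \<sigma> F))"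
proof -
  have "{\<tau> \<in> avoid V F. \<not> \<sigma> \<subseteq> \<tau>} = avoid V (insert \<sigma> F)"
    by (auto simp: avoid_def)
  moreover have "realization V (avoid V F) homotopy_eqv realization V {\<tau> \<in> avoid V F. \<not> \<sigma> \<subseteq> \<tau>}"
  proof (rule collapse_homotopy_eqv)
    fix \<tau> assume \<tau>: "\<tau> \<in> avoid V F" "\<sigma> \<subseteq> \<tau>"
    have "\<not> \<phi> \<subseteq> insert w \<tau>" if \<phi>: "\<phi> \<in> F" for \<phi>
    proof
      assume sub: "\<phi> \<subseteq> insert w \<tau>"
      show False
      proof (cases "w \<in> \<phi>")
        case True
        then obtain \<phi>' where "\<phi>' \<in> F" "\<phi>' \<subseteq> \<sigma> \<union> (\<phi> - {w})"
          using cone \<phi> by blast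
        moreover from this(2) have "\<phi>' \<subseteq> \<tau>"
          using sub \<tau>(2) by blast
        ultimately show False
          using \<tau>(1) by (auto simp: avoid_def)
      qed (use \<phi> sub \<tau>(1) in \<open>auto simp: avoid_def\<close>)
    qed
    then show "insert w \<tau> \<in> avoid V F"
      using \<tau>(1) \<open>w \<in> V\<close> by (auto simp: avoid_def)
  qed (use assms(1-5) avoid_subset in \<open>blast+\<close>)
  ultimately show ?thesis
    by simp
qed

text \<open>The chosen apices lie in no member of \<Sigma>, so forbidding members creates no
  forbidden set through an apex. The cone conditions checked for \<open>F\<close> alone therefore
  survive in any order.\<close>

lemma collapse_avoid_family:
  assumes "finite \<Sigma>" and V: "finite V"
    and step: "\<And>\<sigma>. \<sigma> \<in> \<Sigma> \<Longrightarrow> \<sigma> \<subseteq> V \<and> \<sigma> \<noteq> {} \<and>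
      (\<exists>w\<in>V. w \<notin> \<Union>\<Sigma> \<and> (\<forall>\<phi>\<in>F. w \<in> \<phi> \<longrightarrow> (\<exists>\<phi>'\<in>F. \<phi>' \<subseteq> \<sigma> \<union> (\<phi> - {w}))))"
  shows "realization V (avoid V F) homotopy_eqv realization V (avoid V (F \<union> \<Sigma>))"
proof -
  have "realization V (avoid V F) homotopy_eqv realization V (avoid V (F \<union> \<Sigma>'))" if "finite \<Sigma>'" "\<Sigma>' \<subseteq> \<Sigma>" for \<Sigma>'
    using that
  proof (induction \<Sigma>' rule: finite_induct)
    case (insert \<sigma> \<Sigma>')
    then have "\<sigma> \<in> \<Sigma>"
      by simp
    note st = step[OF this]
    obtain w where w: "w \<in> V" "w \<notin> \<Union>\<Sigma>" "\<forall>\<phi>\<in>F. w \<in> \<phi> \<longrightarrow> (\<exists>\<phi>'\<in>F. \<phi>' \<subseteq> \<sigma> \<union> (\<phi> - {w}))"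
      using conjunct2[OF conjunct2[OF st]] by (elim bexE conjE)
    have \<sigma>: "\<sigma> \<subseteq> V" "\<sigma> \<noteq> {}"
      using conjunct1[OF st] conjunct1[OF conjunct2[OF st]] .
    have "\<forall>\<phi>\<in>F \<union> \<Sigma>'. w \<in> \<phi> \<longrightarrow> (\<exists>\<phi>'\<in>F \<union> \<Sigma>'. \<phi>' \<subseteq> \<sigma> \<union> (\<phi> - {w}))"
    proof (intro ballI impI)
      fix \<phi> assume \<phi>: "\<phi> \<in> F \<union> \<Sigma>'" "w \<in> \<phi>"
      then have "\<phi> \<in> F"
        using w(2) insert.prems by auto
      then show "\<exists>\<phi>'\<in>F \<union> \<Sigma>'. \<phi>' \<subseteq> \<sigma> \<union> (\<phi> - {w})"
        using bspec[OF w(3)] \<phi>(2) by (metis UnI1)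
    qed
    moreover have "w \<notin> \<sigma>"
      using w(2) \<open>\<sigma> \<in> \<Sigma>\<close> by auto
    ultimately have "realization V (avoid V (F \<union> \<Sigma>')) homotopy_eqv realization V (avoid V (insert \<sigma> (F \<union> \<Sigma>')))"
      using V \<sigma> w(1) by (intro collapse_avoid)
    then have "realization V (avoid V (F \<union> \<Sigma>')) homotopy_eqv realization V (avoid V (F \<union> insert \<sigma> \<Sigma>'))"
      by simp
    moreover have "\<Sigma>' \<subseteq> \<Sigma>"
      using insert.prems by simp
    ultimately show ?case
      using homotopy_eqv_trans[OF insert.IH] by metis
  qed (simp add: homotopy_equivalent_space_refl)
  then show ?thesis
    using assms(1) by blast
qed

text \<open>The end of collapsing the cone: forbidding \<open>{p}\<close> deletes \<open>p\<close>,
  and the other members of \<open>G\<close> contain \<open>p\<close>, so they exclude nothing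
  more.\<close>

lemma avoid_remove_vertex:
  assumes "p \<notin> V" "{p} \<in> G" "\<And>\<phi>. \<phi> \<in> G \<Longrightarrow> p \<in> \<phi>"
  shows "avoid (insert p V) (F \<union> G) = avoid V F"
proof -
  have "\<tau> \<in> avoid (insert p V) (F \<union> G) \<longleftrightarrow> \<tau> \<in> avoid V F" for \<tau>
  proof (cases "p \<in> \<tau>")
    case True
    then have "\<tau> \<notin> avoid (insert p V) (F \<union> G)"
      using assms(2) unfolding avoid_def by blast
    moreover have "\<tau> \<notin> avoid V F"
      using assms(1) True unfolding avoid_def by blast
    ultimately show ?thesis
      by simp
  next
    case False
    then have "(\<forall>\<phi>\<in>F \<union> G. \<not> \<phi> \<subseteq> \<tau>) \<longleftrightarrow> (\<forall>\<phi>\<in>F. \<not> \<phi> \<subseteq> \<tau>)"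
      using assms(3) by blast
    moreover have "\<tau> \<subseteq> insert p V \<longleftrightarrow> \<tau> \<subseteq> V"
      using False by blast
    ultimately show ?thesis
      unfolding avoid_def by simp
  qed
  then show ?thesis
    by blast
qed

text \<open>Forbidding each cell together with \<open>p\<close> makes the link of \<open>p\<close>
  the complex without its cells. The members of \<open>F\<close> lie in \<open>V\<close>, so adding
  \<open>p\<close> to a face never completes one of them.\<close>

lemma wedge_of_cells:
  fixes cells :: "'a list list"
  assumes V: "finite V" and p: "p \<notin> V" and F: "\<And>\<phi>. \<phi> \<in> F \<Longrightarrow> \<phi> \<subseteq> V"
    and cells: "cells \<noteq> []" "distinct (map set cells)"
    and cell: "\<And>c. c \<in> set cells \<Longrightarrow> length c = Suc d \<and> distinct c \<and> set c \<in> avoid V F"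
    and maximal: "\<And>c v. c \<in> set cells \<Longrightarrow> v \<in> V - set c \<Longrightarrow> \<exists>\<phi>\<in>F. \<phi> \<subseteq> insert v (set c)"
  defines "G \<equiv> (\<lambda>c. insert p (set c)) ` set cells"
  shows "realization (insert p V) (avoid (insert p V) (F \<union> G)) homotopy_eqv wedge_spheres_set (length cells) d"
proof -
  let ?K = "avoid (insert p V) (F \<union> G)" and ?\<nu> = "\<lambda>i j. cells ! i ! j"
  have image: "?\<nu> i ` {..d} = set (cells ! i)" if "i < length cells" for i
  proof -
    have "{..d} = {..<length (cells ! i)}"
      using cell[OF nth_mem[OF that]] by auto
    then show ?thesis
      by (auto simp: set_conv_nth)
  qed
  have subV: "set c \<subseteq> V" if "c \<in> set cells" for c
    using cell[OF that] by (simp add: avoid_def)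
  have max: "\<tau> = set c" if c: "c \<in> set cells" and \<tau>: "\<tau> \<in> ?K" "set c \<subseteq> \<tau>" for c \<tau>
  proof (rule ccontr)
    assume "\<tau> \<noteq> set c"
    then obtain v where v: "v \<in> \<tau>" "v \<notin> set c"
      using \<tau>(2) by blast
    then have "insert v (set c) \<subseteq> \<tau>"
      using \<tau>(2) by blast
    moreover have "\<exists>\<phi>\<in>F \<union> G. \<phi> \<subseteq> insert v (set c)"
    proof (cases "v = p")
      case True
      then show ?thesis using c by (auto simp: G_def)
    next
      case False
      then have "v \<in> V - set c"
        using v \<tau>(1) by (auto simp: avoid_def)
      then show ?thesis using maximal[OF c] by blast
    qed
    ultimately obtain \<phi> where "\<phi> \<in> F \<union> G" "\<phi> \<subseteq> \<tau>"
      by blast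
    then show False
      using \<tau>(1) by (auto simp: avoid_def)
  qed
  interpret coned_cells "insert p V" ?K p ?\<nu> "length cells" d
  proof
    show "\<tau>' \<in> ?K" if "\<tau> \<in> ?K" "\<tau>' \<subseteq> \<tau>" for \<tau> \<tau>'
      using that by (rule avoid_subset)
    show "inj_on (?\<nu> i) {..d}" if "i < length cells" for i
      using cell[OF nth_mem[OF that]] by (auto simp: inj_on_def nth_eq_iff_index_eq)
    show "?\<nu> i j \<noteq> p" if "i < length cells" "j \<le> d" for i j
      using image[OF that(1)] subV[OF nth_mem[OF that(1)]] that(2) p by blast
    show "?\<nu> i ` {..d} \<in> ?K" if "i < length cells" for i
    proof -
      have "set (cells ! i) \<in> avoid V F" "p \<notin> set (cells ! i)"
        using cell[OF nth_mem[OF that]] subV[OF nth_mem[OF that]] p by auto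
      then have "set (cells ! i) \<in> ?K"
        by (auto simp: avoid_def G_def)
      then show ?thesis
        using image[OF that] by simp
    qed
    show "i = i'" if "i < length cells" "i' < length cells" "?\<nu> i ` {..d} = ?\<nu> i' ` {..d}" for i i'
    proof -
      have "map set cells ! i = map set cells ! i'"
        using image that by simp
      then show ?thesis
        using cells(2) that(1,2) nth_eq_iff_index_eq by fastforce
    qed
    show "\<tau> = ?\<nu> i ` {..d}" if "i < length cells" "\<tau> \<in> ?K" "?\<nu> i ` {..d} \<subseteq> \<tau>" for i \<tau>
      using max[OF nth_mem[OF that(1)] that(2)] that image by simp
    show "insert p \<tau> \<in> ?K" if \<tau>: "\<tau> \<in> ?K" "\<And>i. i < length cells \<Longrightarrow> \<tau> \<noteq> ?\<nu> i ` {..d}" for \<tau>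
    proof -
      have "\<not> \<phi> \<subseteq> insert p \<tau>" if "\<phi> \<in> F" for \<phi>
        using \<tau>(1) that F[OF that] p by (auto simp: avoid_def)
      moreover have "\<not> insert p (set c) \<subseteq> insert p \<tau>" if c: "c \<in> set cells" for c
      proof
        assume "insert p (set c) \<subseteq> insert p \<tau>"
        then have "set c \<subseteq> \<tau>"
          using subV[OF c] p by blast
        then have "\<tau> = set c"
          using max[OF c \<tau>(1)] by blast
        then show False
          using \<tau>(2) c image by (metis in_set_conv_nth)
      qed
      ultimately show ?thesis
        using \<tau>(1) by (auto simp: avoid_def G_def)
    qed
  qed (use V cells(1) in \<open>auto simp: avoid_def\<close>)
  show ?thesis
    using homotopy_eqv_wedge simplex_boundary_wedge_homotopy_eqv by (rule homotopy_eqv_trans)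
qed

section \<open>Two-matchings of wheels\<close>

definition claws :: "'v set set \<Rightarrow> 'v set set set" where
  "claws E = {\<phi>. \<phi> \<subseteq> E \<and> card \<phi> = 3 \<and> (\<exists>v. \<forall>e\<in>\<phi>. v \<in> e)}"

text \<open>A degree above 2 means three chosen edges at one vertex, so the claws are the minimal
  nonfaces. Finiteness matters because an infinite set has \<open>card\<close> 0 and would pass the
  degree bound.\<close>

lemma two_matching_complex_avoid:
  assumes "finite E"
  shows "two_matching_complex E = avoid E (claws E)"
proof -
  have "two_matching E H \<longleftrightarrow> H \<in> avoid E (claws E)" if H: "H \<subseteq> E" for H
  proof
    assume "two_matching E H"
    then have le: "card {e \<in> H. v \<in> e} \<le> 2" for v
      by (simp add: two_matching_def)
    have "\<not> \<phi> \<subseteq> H" if \<phi>: "\<phi> \<in> claws E" for \<phi>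
    proof
      assume "\<phi> \<subseteq> H"
      moreover obtain v where "\<forall>e\<in>\<phi>. v \<in> e" "card \<phi> = 3"
        using \<phi> by (auto simp: claws_def)
      ultimately have "\<phi> \<subseteq> {e \<in> H. v \<in> e}" "card \<phi> = 3"
        by blast+
      then have "3 \<le> card {e \<in> H. v \<in> e}"
        using card_mono[of "{e \<in> H. v \<in> e}" \<phi>] finite_subset[OF H assms] by simp
      then show False
        using le[of v] by simp
    qed
    then show "H \<in> avoid E (claws E)"
      using H by (auto simp: avoid_def)
  next
    assume av: "H \<in> avoid E (claws E)"
    have "card {e \<in> H. v \<in> e} \<le> 2" for v
    proof (rule ccontr)
      assume "\<not> ?thesis"
      then have "3 \<le> card {e \<in> H. v \<in> e}"
        by simp
      then obtain \<phi> where "\<phi> \<subseteq> {e \<in> H. v \<in> e}" "card \<phi> = 3"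
        by (rule obtain_subset_with_card_n)
      then have "\<phi> \<in> claws E" "\<phi> \<subseteq> H"
        using H by (auto simp: claws_def)
      then show False
        using av by (auto simp: avoid_def)
    qed
    then show "two_matching E H"
      using H by (simp add: two_matching_def)
  qed
  moreover have "two_matching E H \<Longrightarrow> H \<subseteq> E" "H \<in> avoid E (claws E) \<Longrightarrow> H \<subseteq> E" for H
    by (auto simp: two_matching_def avoid_def)
  ultimately show ?thesis
    by (auto simp: two_matching_complex_def)
qed

section \<open>Spokes, rim edges and claws of the wheel with hub 0 and m = n - 1 rim
  vertices\<close>

definition spoke :: "nat \<Rightarrow> nat set" where
  "spoke i = {0, i}"

definition next_rim :: "nat \<Rightarrow> nat \<Rightarrow> nat" where
  "next_rim m t = (if t = m then 1 else Suc t)"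

definition rim :: "nat \<Rightarrow> nat \<Rightarrow> nat set" where
  "rim m t = {t, next_rim m t}"

lemma wheel_edges_eq:
  assumes "1 \<le> m"
  shows "wheel_edges (Suc m) = spoke ` {1..m} \<union> rim m ` {1..m}"
proof -
  have "{{i, i + 1} | i. 1 \<le> i \<and> i < m} \<union> {{m, 1}} = rim m ` {1..m}" (is "?A = ?B")
  proof
    show "?A \<subseteq> ?B"
    proof
      fix e assume "e \<in> ?A"
      then consider i where "1 \<le> i" "i < m" "e = {i, i + 1}" | "e = {m, 1}"
        by auto
      then show "e \<in> ?B"
      proof cases
        case 1
        then show ?thesis by (intro image_eqI[of _ _ i]) (auto simp: rim_def next_rim_def)
      next
        case 2
        then show ?thesis using assms by (intro image_eqI[of _ _ m]) (auto simp: rim_def next_rim_def)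
      qed
    qed
    show "?B \<subseteq> ?A"
      by (force simp: rim_def next_rim_def)
  qed
  moreover have "{{0, i} | i. 1 \<le> i \<and> i \<le> m} = spoke ` {1..m}"
    by (auto simp: spoke_def)
  ultimately show ?thesis
    unfolding wheel_edges_def diff_Suc_1 Un_assoc by (simp only:)
qed

lemma finite_wheel_edges: "1 \<le> m \<Longrightarrow> finite (wheel_edges (Suc m))"
  by (simp add: wheel_edges_eq)

lemma next_rim_range: "t \<in> {1..m} \<Longrightarrow> next_rim m t \<in> {1..m}"
  by (auto simp: next_rim_def)

lemma next_rim_inj: "t \<in> {1..m} \<Longrightarrow> t' \<in> {1..m} \<Longrightarrow> next_rim m t = next_rim m t' \<Longrightarrow> t = t'"
  by (cases "t = m"; cases "t' = m") (simp_all add: next_rim_def)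

lemma spoke_inj: "spoke i = spoke j \<longleftrightarrow> i = j"
  by (auto simp: spoke_def doubleton_eq_iff)

lemma rim_not_spoke: "t \<in> {1..m} \<Longrightarrow> rim m t \<noteq> spoke i"
  by (auto simp: rim_def spoke_def next_rim_def doubleton_eq_iff)

text \<open>The common vertex of the claw is an end of the rim edge. Only two rim edges meet there,
  so the third edge of the claw is the spoke to that vertex. This is what makes a rim edge away from
  given spokes an apex.\<close>

lemma claw_with_rim_edge:
  assumes m: "1 \<le> m" and \<phi>: "\<phi> \<in> claws (wheel_edges (Suc m))" and t: "t \<in> {1..m}" "rim m t \<in> \<phi>"
  obtains v where "v \<in> {1..m}" "v \<in> rim m t" "spoke v \<in> \<phi>"
proof -
  obtain v where v: "\<And>e. e \<in> \<phi> \<Longrightarrow> v \<in> e" and card: "card \<phi> = 3"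
    and sub: "\<phi> \<subseteq> spoke ` {1..m} \<union> rim m ` {1..m}"
    using \<phi> m by (auto simp: claws_def wheel_edges_eq)
  have vt: "v \<in> rim m t"
    using v t by blast
  then have v1: "v \<in> {1..m}"
    using t next_rim_range[of t m] by (auto simp: rim_def)
  have "spoke v \<in> \<phi>"
  proof (rule ccontr)
    assume ns: "spoke v \<notin> \<phi>"
    define P where "P = {t \<in> {1..m}. next_rim m t = v}"
    have "\<phi> \<subseteq> insert (rim m v) (rim m ` P)"
    proof
      fix e assume e: "e \<in> \<phi>"
      then consider i where "i \<in> {1..m}" "e = spoke i" | i where "i \<in> {1..m}" "e = rim m i"
        using sub by blast
      then show "e \<in> insert (rim m v) (rim m ` P)"
      proof cases
        case 1
        then have "i = v"
          using v[OF e] v1 by (auto simp: spoke_def)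
        then show ?thesis using 1 e ns by blast
      next
        case 2
        then show ?thesis
          using v[OF e] by (auto simp: rim_def P_def)
      qed
    qed
    moreover have "card (rim m ` P) \<le> 1"
    proof -
      have "t = t'" if "t \<in> P" "t' \<in> P" for t t'
        using that next_rim_inj[of t m t'] by (simp add: P_def)
      then have "card P \<le> Suc 0"
        by (simp add: card_le_Suc0_iff_eq P_def)
      moreover have "card (rim m ` P) \<le> card P"
        by (rule card_image_le) (simp add: P_def)
      ultimately show ?thesis
        by simp
    qed
    moreover have "finite (rim m ` P)"
      by (simp add: P_def)
    ultimately have "card \<phi> \<le> 2"
      using card_mono[of "insert (rim m v) (rim m ` P)" \<phi>] card_insert_le_m1[of 2 "rim m ` P" "rim m v"] by simp
    then show False
      using card by simp
  qed
  with v1 vt show ?thesis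
    by (rule that)
qed

lemma spokes_claw:
  assumes "1 \<le> m" "\<phi> \<subseteq> spoke ` {1..m}" "card \<phi> = 3"
  shows "\<phi> \<in> claws (wheel_edges (Suc m))"
proof -
  have "\<forall>e\<in>\<phi>. 0 \<in> e"
    using assms(2) by (auto simp: spoke_def)
  then show ?thesis
    using assms by (auto simp: claws_def wheel_edges_eq)
qed

text \<open>A vertex excludes only its own index and that of its cyclic predecessor, so two vertices
  exclude at most four indices; this is where n \<ge> 6 enters.\<close>

lemma rim_edge_avoiding:
  assumes "5 \<le> m"
  obtains t where "t \<in> {1..m}" "i \<notin> rim m t" "j \<notin> rim m t"
proof -
  have sub1: "\<exists>a. {t \<in> {1..m}. next_rim m t = x} \<subseteq> {a}" for x
    using next_rim_inj by blast
  obtain a b where ab: "{t \<in> {1..m}. next_rim m t = i} \<subseteq> {a}" "{t \<in> {1..m}. next_rim m t = j} \<subseteq> {b}"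
    using sub1[of i] sub1[of j] by blast
  have "card {i, j, a, b} \<le> 4"
    using card_length[of "[i, j, a, b]"] by simp
  have "\<not> {1..m} \<subseteq> {i, j, a, b}"
  proof
    assume "{1..m} \<subseteq> {i, j, a, b}"
    then have "card {1..m} \<le> card {i, j, a, b}"
      by (intro card_mono) auto
    then show False
      using \<open>card {i, j, a, b} \<le> 4\<close> assms by simp
  qed
  then obtain t where "t \<in> {1..m}" "t \<notin> {i, j, a, b}"
    by blast
  then show ?thesis
    using ab by (intro that[of t]) (auto simp: rim_def)
qed

section \<open>The contractible wheels\<close>

lemma contractible_full_simplex:
  assumes "finite V" "R \<subseteq> V" "v \<in> R"
  shows "contractible (realization V (Pow R))"
proof -
  define c where "c = (\<lambda>u. if u = v then 1 else 0 :: real)"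
  have c: "c \<in> realization V (Pow R)"
    using assms by (auto simp: realization_def c_def)
  have "homotopic_with_canon (\<lambda>_. True) (realization V (Pow R)) (realization V (Pow R)) id (\<lambda>_. c)"
  proof (rule homotopic_segments)
    fix s :: real and f
    assume s: "0 \<le> s" "s \<le> 1" and f: "f \<in> realization V (Pow R)"
    have "sum (\<lambda>u. (1 - s) * f u + s * c u) V = (1 - s) * sum f V + s * sum c V"
      by (simp add: sum.distrib sum_distrib_left)
    then have "sum (\<lambda>u. (1 - s) * f u + s * c u) V = 1"
      using realizationD(3)[OF f] realizationD(3)[OF c] by simp
    moreover have "{u. (1 - s) * f u + s * c u \<noteq> 0} \<subseteq> R"
    proof
      fix u assume "u \<in> {u. (1 - s) * f u + s * c u \<noteq> 0}"
      then have "f u \<noteq> 0 \<or> c u \<noteq> 0"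
        by auto
      then show "u \<in> R"
        using realizationD(4)[OF f] realizationD(4)[OF c] by blast
    qed
    ultimately show "(\<lambda>u. (1 - s) * id f u + s * c u) \<in> realization V (Pow R)"
      using s realizationD(1,2)[OF f] realizationD(1,2)[OF c] by (simp add: realization_def)
  qed (simp_all add: id_def)
  then show ?thesis
    unfolding contractible_def by blast
qed

lemma homotopy_equivalent_point:
  assumes "X homotopy_equivalent_space Y" "contractible_space Y" "topspace X \<noteq> {}"
  shows "X homotopy_equivalent_space discrete_topology {()}"
proof -
  have "contractible_space X"
    using assms(1,2) homotopy_equivalent_space_contractibility by blast
  then obtain a where "a \<in> topspace X" "X homotopy_equivalent_space (subtopology X {a})"
    using assms(3) contractible_eq_homotopy_equivalent_singleton_subtopology[of X] by auto
  moreover have "subtopology X {a} = discrete_topology {a}"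
    using \<open>a \<in> topspace X\<close> by (simp add: subtopology_eq_discrete_topology_sing)
  moreover have "discrete_topology {a} homeomorphic_space discrete_topology {()}"
    unfolding homeomorphic_space_def homeomorphic_maps_def
    by (intro exI[of _ "\<lambda>_. ()"] exI[of _ "\<lambda>_. a"]) auto
  ultimately show ?thesis
    using homotopy_eqv_trans homeomorphic_imp_homotopy_equivalent_space by metis
qed

text \<open>Take a rim edge missing i and j. A claw through it contains the spoke to one of its ends
  v, which differs from i and j, so the spokes to i, j, v already form a claw at the hub: this is
  the cone condition for the pair. Once pairs are forbidden, the pair of spokes to i and v serves in
  the same way for a single spoke.\<close>

lemma wheel_contractible:
  assumes m: "5 \<le> m"
  defines "E \<equiv> wheel_edges (Suc m)"
  shows "realization_space E (two_matching_complex E) homotopy_equivalent_space discrete_topology {()}"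
proof -
  let ?S = "spoke ` {1..m}" and ?R = "rim m ` {1..m}"
  define pairs where "pairs = {\<sigma>. \<sigma> \<subseteq> ?S \<and> card \<sigma> = 2}"
  define singles where "singles = (\<lambda>s. {s}) ` ?S"
  have m1: "1 \<le> m" using m by simp
  have E: "E = ?S \<union> ?R" and finE: "finite E"
    using wheel_edges_eq[OF m1] finite_wheel_edges[OF m1] by (simp_all add: E_def)
  have disj: "rim m t \<notin> ?S" if "t \<in> {1..m}" for t
    using rim_not_spoke[OF that] by blast
  have "realization E (avoid E (claws E)) homotopy_eqv realization E (avoid E (claws E \<union> pairs))"
  proof (rule collapse_avoid_family)
    show "finite pairs"
      by (rule finite_subset[of _ "Pow ?S"]) (auto simp: pairs_def)
    fix \<sigma> assume \<sigma>: "\<sigma> \<in> pairs"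
    then have "\<sigma> \<subseteq> ?S" "card \<sigma> = 2"
      by (simp_all add: pairs_def)
    then obtain x y where xy: "\<sigma> = {x, y}" "x \<noteq> y"
      using card_2_iff[of \<sigma>] by metis
    have "x \<in> ?S" "y \<in> ?S"
      using \<open>\<sigma> \<subseteq> ?S\<close> unfolding xy(1) by simp_all
    then obtain i j where "i \<in> {1..m}" "x = spoke i" "j \<in> {1..m}" "y = spoke j"
      by (elim imageE)
    with xy have ij: "i \<in> {1..m}" "j \<in> {1..m}" "i \<noteq> j" "\<sigma> = {spoke i, spoke j}"
      by auto
    obtain t where t: "t \<in> {1..m}" "i \<notin> rim m t" "j \<notin> rim m t"
      using rim_edge_avoiding[OF m] .
    have star: "\<exists>\<phi>'\<in>claws E. \<phi>' \<subseteq> \<sigma> \<union> (\<phi> - {rim m t})" if \<phi>: "\<phi> \<in> claws E" "rim m t \<in> \<phi>" for \<phi>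
    proof -
      obtain v where v: "v \<in> {1..m}" "v \<in> rim m t" "spoke v \<in> \<phi>"
        using claw_with_rim_edge[OF m1 _ t(1)] \<phi> unfolding E_def by metis
      have ne: "v \<noteq> i" "v \<noteq> j"
        using v t by auto
      have "{spoke i, spoke j, spoke v} \<in> claws E"
        unfolding E_def using ij v ne by (intro spokes_claw m1) (auto simp: spoke_inj)
      moreover have "spoke v \<in> \<phi> - {rim m t}"
        using v disj[OF t(1)] by auto
      ultimately show ?thesis
        using ij(4) by (intro bexI[of _ "{spoke i, spoke j, spoke v}"]) auto
    qed
    have fresh: "rim m t \<notin> \<Union>pairs"
      using disj[OF t(1)] by (auto simp: pairs_def)
    have "\<sigma> \<subseteq> E" "\<sigma> \<noteq> {}" "rim m t \<in> E"
      using ij t(1) by (auto simp: E)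
    then show "\<sigma> \<subseteq> E \<and> \<sigma> \<noteq> {} \<and> (\<exists>w\<in>E. w \<notin> \<Union>pairs \<and>
        (\<forall>\<phi>\<in>claws E. w \<in> \<phi> \<longrightarrow> (\<exists>\<phi>'\<in>claws E. \<phi>' \<subseteq> \<sigma> \<union> (\<phi> - {w}))))"
      by (intro conjI bexI[of _ "rim m t"] ballI impI fresh star)
  qed (rule finE)
  also have "realization E (avoid E (claws E \<union> pairs)) homotopy_eqv realization E (avoid E (claws E \<union> pairs \<union> singles))"
  proof (rule collapse_avoid_family)
    show "finite singles"
      by (simp add: singles_def)
    fix \<sigma> assume \<sigma>: "\<sigma> \<in> singles"
    then obtain i where i: "i \<in> {1..m}" "\<sigma> = {spoke i}"
      by (auto simp: singles_def)
    obtain t where t: "t \<in> {1..m}" "i \<notin> rim m t"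
      using rim_edge_avoiding[OF m] by metis
    have star: "\<exists>\<phi>'\<in>claws E \<union> pairs. \<phi>' \<subseteq> \<sigma> \<union> (\<phi> - {rim m t})" if \<phi>: "\<phi> \<in> claws E \<union> pairs" "rim m t \<in> \<phi>" for \<phi>
    proof -
      have "\<phi> \<in> claws E"
        using \<phi> disj[OF t(1)] by (auto simp: pairs_def)
      then obtain v where v: "v \<in> {1..m}" "v \<in> rim m t" "spoke v \<in> \<phi>"
        using claw_with_rim_edge[OF m1 _ t(1)] \<phi>(2) unfolding E_def by metis
      have ne: "v \<noteq> i"
        using v t by auto
      have "{spoke i, spoke v} \<in> pairs"
        using i v ne by (auto simp: pairs_def spoke_inj)
      moreover have "spoke v \<in> \<phi> - {rim m t}"
        using v disj[OF t(1)] by auto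
      ultimately show ?thesis
        using i(2) by (intro bexI[of _ "{spoke i, spoke v}"]) auto
    qed
    have fresh: "rim m t \<notin> \<Union>singles"
      using disj[OF t(1)] by (auto simp: singles_def)
    have "\<sigma> \<subseteq> E" "\<sigma> \<noteq> {}" "rim m t \<in> E"
      using i t(1) by (auto simp: E)
    then show "\<sigma> \<subseteq> E \<and> \<sigma> \<noteq> {} \<and> (\<exists>w\<in>E. w \<notin> \<Union>singles \<and>
        (\<forall>\<phi>\<in>claws E \<union> pairs. w \<in> \<phi> \<longrightarrow> (\<exists>\<phi>'\<in>claws E \<union> pairs. \<phi>' \<subseteq> \<sigma> \<union> (\<phi> - {w}))))"
      by (intro conjI bexI[of _ "rim m t"] ballI impI fresh star)
  qed (rule finE)
  also have "avoid E (claws E \<union> pairs \<union> singles) = Pow ?R"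
  proof
    show "avoid E (claws E \<union> pairs \<union> singles) \<subseteq> Pow ?R"
    proof (intro subsetI PowI)
      fix \<tau> e assume \<tau>: "\<tau> \<in> avoid E (claws E \<union> pairs \<union> singles)" and e: "e \<in> \<tau>"
      have "{e} \<notin> singles"
        using \<tau> e unfolding avoid_def by blast
      then have "e \<notin> ?S"
        unfolding singles_def by blast
      moreover have "e \<in> E"
        using \<tau> e unfolding avoid_def by blast
      ultimately show "e \<in> ?R"
        unfolding E by blast
    qed
    have "\<not> \<phi> \<subseteq> ?R" if \<phi>: "\<phi> \<in> claws E" for \<phi>
    proof
      assume sub: "\<phi> \<subseteq> ?R"
      have "\<phi> \<noteq> {}"
        using \<phi> by (auto simp: claws_def)
      then obtain t where "t \<in> {1..m}" "rim m t \<in> \<phi>"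
        using sub by blast
      then obtain v where "v \<in> {1..m}" "spoke v \<in> \<phi>"
        using claw_with_rim_edge[OF m1] \<phi> unfolding E_def by metis
      then show False
        using sub disj by blast
    qed
    moreover have "\<not> \<phi> \<subseteq> ?R" if \<phi>: "\<phi> \<in> pairs \<union> singles" for \<phi>
    proof
      assume sub: "\<phi> \<subseteq> ?R"
      have "\<phi> \<noteq> {}"
        using \<phi> by (auto simp: pairs_def singles_def)
      moreover have "\<phi> \<subseteq> ?S"
        using \<phi> by (auto simp: pairs_def singles_def)
      ultimately show False
        using sub disj by blast
    qed
    ultimately have "?R \<in> avoid E (claws E \<union> pairs \<union> singles)"
      unfolding avoid_def E by blast
    then show "Pow ?R \<subseteq> avoid E (claws E \<union> pairs \<union> singles)"
      using avoid_subset by blast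
  qed
  finally have hom: "realization E (avoid E (claws E)) homotopy_eqv realization E (Pow ?R)" .
  have R1: "rim m 1 \<in> ?R"
    using m1 by auto
  \<comment> \<open>The empty space also counts as contractible, so a point has to be
    exhibited.\<close>
  have "(\<lambda>e. if e = rim m 1 then 1 else 0) \<in> realization E (avoid E (claws E))"
  proof -
    have "\<not> \<phi> \<subseteq> {rim m 1}" if "\<phi> \<in> claws E" for \<phi>
      using that card_mono[of "{rim m 1}" \<phi>] by (auto simp: claws_def)
    then have "{rim m 1} \<in> avoid E (claws E)"
      using R1 unfolding avoid_def E by blast
    moreover have "rim m 1 \<in> E"
      using R1 unfolding E by blast
    ultimately show ?thesis
      using finE by (auto simp: realization_def)
  qed
  then have "realization E (avoid E (claws E)) \<noteq> {}"
    by blast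
  moreover have "contractible (realization E (Pow ?R))"
    by (rule contractible_full_simplex[OF finE _ R1]) (simp add: E)
  ultimately show ?thesis
    unfolding two_matching_complex_avoid[OF finE] realization_space_eq
    by (intro homotopy_equivalent_point[OF hom]) simp_all
qed

text \<open>Each entry is a face to remove with its apex, checked against the forbidden family as it
  stands at that moment. For concrete lists of distinct vertices \<open>simp\<close> decides the
  predicate.\<close>

fun collapsible :: "'a set \<Rightarrow> 'a set set \<Rightarrow> ('a set \<times> 'a) list \<Rightarrow> bool" where
  "collapsible V F [] \<longleftrightarrow> True"
| "collapsible V F ((\<sigma>, w) # xs) \<longleftrightarrow> \<sigma> \<subseteq> V \<and> \<sigma> \<noteq> {} \<and> w \<in> V \<and> w \<notin> \<sigma> \<and>
     (\<forall>\<phi>\<in>F. w \<in> \<phi> \<longrightarrow> (\<exists>\<phi>'\<in>F. \<phi>' \<subseteq> \<sigma> \<union> (\<phi> - {w}))) \<and> collapsible V (insert \<sigma> F) xs"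

lemma collapsible_homotopy_eqv:
  assumes "finite V" "collapsible V F xs"
  shows "realization V (avoid V F) homotopy_eqv realization V (avoid V (F \<union> fst ` set xs))"
  using assms(2)
proof (induction xs arbitrary: F)
  case Nil
  show ?case
    by (simp add: homotopy_equivalent_space_refl)
next
  case (Cons x xs)
  obtain \<sigma> w where x: "x = (\<sigma>, w)"
    by force
  have c: "collapsible V F ((\<sigma>, w) # xs)"
    using Cons.prems by (simp only: x)
  have "realization V (avoid V F) homotopy_eqv realization V (avoid V (insert \<sigma> F))"
    using c[unfolded collapsible.simps] by (elim conjE) (rule collapse_avoid[OF assms(1)])
  also have "realization V (avoid V (insert \<sigma> F)) homotopy_eqv realization V (avoid V (insert \<sigma> F \<union> fst ` set xs))"
    by (rule Cons.IH) (use c in \<open>simp only: collapsible.simps\<close>)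
  also have "insert \<sigma> F \<union> fst ` set xs = F \<union> fst ` set (x # xs)"
    by (simp add: x)
  finally show ?case .
qed

text \<open>Coning off the faces other than the cells does not change the homotopy type, because the cone
  collapses back to the original complex.\<close>

lemma wedge_of_cells_collapsible:
  fixes cells :: "'a list list"
  assumes V: "finite V" and p: "p \<notin> V" and F: "\<And>\<phi>. \<phi> \<in> F \<Longrightarrow> \<phi> \<subseteq> V"
    and cells: "cells \<noteq> []" "distinct (map set cells)"
    and cell: "\<And>c. c \<in> set cells \<Longrightarrow> length c = Suc d \<and> distinct c \<and> set c \<in> avoid V F"
    and maximal: "\<And>c v. c \<in> set cells \<Longrightarrow> v \<in> V - set c \<Longrightarrow> \<exists>\<phi>\<in>F. \<phi> \<subseteq> insert v (set c)"
    and xs: "collapsible (insert p V) (F \<union> (\<lambda>c. insert p (set c)) ` set cells) xs"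
      "{p} \<in> fst ` set xs" "\<forall>\<sigma>\<in>fst ` set xs. p \<in> \<sigma>"
  shows "realization V (avoid V F) homotopy_eqv wedge_spheres_set (length cells) d"
proof -
  define G where "G = (\<lambda>c. insert p (set c)) ` set cells"
  have "realization (insert p V) (avoid (insert p V) (F \<union> G)) homotopy_eqv
      realization (insert p V) (avoid (insert p V) (F \<union> G \<union> fst ` set xs))"
    unfolding G_def by (rule collapsible_homotopy_eqv) (use V xs(1) in auto)
  also have "avoid (insert p V) (F \<union> G \<union> fst ` set xs) = avoid V F"
    unfolding Un_assoc using xs(2,3) by (intro avoid_remove_vertex p) (auto simp: G_def)
  also have "realization (insert p V) (avoid V F) = realization V (avoid V F)"
    using V by (intro realization_mono_vertices) (auto simp: avoid_def)
  finally have "realization V (avoid V F) homotopy_eqv realization (insert p V) (avoid (insert p V) (F \<union> G))"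
    by (rule homotopy_equivalent_space_sym[THEN iffD1])
  also have "realization (insert p V) (avoid (insert p V) (F \<union> G)) homotopy_eqv wedge_spheres_set (length cells) d"
    unfolding G_def by (rule wedge_of_cells[OF V p F cells cell maximal])
  finally show ?thesis .
qed

text \<open>The rim edges \<open>r1\<close>, \<open>r2\<close>, \<open>r3\<close> are 12, 23, 31. In
  the link of \<open>{s1, s2}\<close> the vertex \<open>r1\<close> is isolated, because it forms a
  claw with \<open>r3\<close> at 1 and with \<open>r2\<close> at 2, while \<open>r2\<close> and
  \<open>r3\<close> span a segment. Dropping the cell \<open>{s1, s2, r1}\<close> leaves the
  segment, which is a cone; the other pairs are symmetric.\<close>

lemma three_two_spheres:
  fixes s1 s2 s3 r1 r2 r3 p :: 'a
  assumes dist: "distinct [s1, s2, s3, r1, r2, r3, p]"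
  defines "V \<equiv> {s1, s2, s3, r1, r2, r3}"
    and "F \<equiv> {{s1, s2, s3}, {s1, r3, r1}, {s2, r1, r2}, {s3, r2, r3}}"
  shows "realization V (avoid V F) homotopy_eqv wedge_spheres_set 3 2"
proof -
  \<comment> \<open>\<open>distinct\<close> yields each inequality in one orientation only; the
    reversed list supplies the other for \<open>simp\<close>.\<close>
  note dist' = distinct_rev[THEN iffD2, OF dist]
  let ?cells = "[[s1, s2, r1], [s2, s3, r2], [s1, s3, r3]]"
  \<comment> \<open>Every face contains \<open>p\<close>, since the collapses take place in its
    link. The apex for a single spoke is the rim edge opposite to it; the last link is the full
    triangle of rim edges, where any apex works.\<close>
  let ?xs = "[({p, s1, s2}, r2), ({p, s2, s3}, r3), ({p, s1, s3}, r1), ({p, s1}, r2), ({p, s2}, r3),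
      ({p, s3}, r1), ({p}, r1)]"
  have "realization V (avoid V F) homotopy_eqv wedge_spheres_set (length ?cells) 2"
  proof (rule wedge_of_cells_collapsible)
    show "collapsible (insert p V) (F \<union> (\<lambda>c. insert p (set c)) ` set ?cells) ?xs"
      unfolding V_def F_def using dist dist' by simp
    have "\<not> set [s1, s2, r1] \<subseteq> set [s2, s3, r2]" "\<not> set [s1, s2, r1] \<subseteq> set [s1, s3, r3]" "\<not> set [s2, s3, r2] \<subseteq> set [s1, s3, r3]"
      using dist dist' by simp_all
    then have "set [s1, s2, r1] \<noteq> set [s2, s3, r2]" "set [s1, s2, r1] \<noteq> set [s1, s3, r3]" "set [s2, s3, r2] \<noteq> set [s1, s3, r3]"
      by (metis order_refl)+
    then show "distinct (map set ?cells)"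
      by (simp only: list.map distinct_length_2_or_more distinct_singleton simp_thms)
    have "\<forall>c\<in>set ?cells. length c = Suc 2 \<and> distinct c \<and> set c \<in> avoid V F"
      using dist dist' unfolding V_def F_def avoid_def by simp
    then show "length c = Suc 2 \<and> distinct c \<and> set c \<in> avoid V F" if "c \<in> set ?cells" for c
      using that by (rule bspec)
    have "\<forall>c\<in>set ?cells. \<forall>v\<in>V - set c. \<exists>\<phi>\<in>F. \<phi> \<subseteq> insert v (set c)"
      unfolding V_def F_def using dist dist' by (simp add: insert_Diff_if)
    from bspec[OF bspec[OF this]] show "\<exists>\<phi>\<in>F. \<phi> \<subseteq> insert v (set c)" if "c \<in> set ?cells" "v \<in> V - set c" for c v
      using that .
  qed (use dist dist' in \<open>auto simp: V_def F_def\<close>)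
  then show ?thesis
    by (simp add: numeral_3_eq_3)
qed

text \<open>The rim edges \<open>a\<close>, \<open>b\<close>, \<open>c\<close>, \<open>d\<close> are
  12, 23, 34, 41. The link of the opposite spokes \<open>s1\<close>, \<open>s3\<close> is the circle
  a - b - d - c - a, and the cell accounts for its edge \<open>{a, c}\<close>. For
  \<open>s2\<close>, \<open>s4\<close> the circle is a - c - b - d - a and the edge is
  \<open>{b, d}\<close>.\<close>

lemma two_three_spheres:
  fixes s1 s2 s3 s4 a b c d p :: 'a
  assumes dist: "distinct [s1, s2, s3, s4, a, b, c, d, p]"
  defines "V \<equiv> {s1, s2, s3, s4, a, b, c, d}"
    and "F \<equiv> {{s1, s2, s3}, {s1, s2, s4}, {s1, s3, s4}, {s2, s3, s4},
      {s1, d, a}, {s2, a, b}, {s3, b, c}, {s4, c, d}}"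
  shows "realization V (avoid V F) homotopy_eqv wedge_spheres_set 2 3"
proof -
  note dist' = distinct_rev[THEN iffD2, OF dist]
  let ?cells = "[[s1, s3, a, c], [s2, s4, b, d]]"
  \<comment> \<open>The path left of each circle is shortened from both ends: \<open>a\<close> hangs
    only on \<open>b\<close> and \<open>c\<close> only on \<open>d\<close>, which leaves the edge
    \<open>{b, d}\<close>; similarly for \<open>s2\<close>, \<open>s4\<close>. An adjacent pair of
    spokes has the rim edge missing both of its ends as apex.\<close>
  let ?xs = "[({p, s1, s3, a}, b), ({p, s1, s3, c}, d), ({p, s1, s3}, b),
      ({p, s2, s4, b}, c), ({p, s2, s4, d}, a), ({p, s2, s4}, c),
      ({p, s1, s2}, c), ({p, s2, s3}, d), ({p, s3, s4}, a), ({p, s4, s1}, b),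
      ({p, s1}, b), ({p, s2}, c), ({p, s3}, a), ({p, s4}, a), ({p}, a)]"
  have "realization V (avoid V F) homotopy_eqv wedge_spheres_set (length ?cells) 3"
  proof (rule wedge_of_cells_collapsible)
    show "collapsible (insert p V) (F \<union> (\<lambda>c. insert p (set c)) ` set ?cells) ?xs"
      unfolding V_def F_def using dist dist' by simp
    have "\<not> set [s1, s3, a, c] \<subseteq> set [s2, s4, b, d]"
      using dist dist' by simp_all
    then have "set [s1, s3, a, c] \<noteq> set [s2, s4, b, d]"
      by (metis order_refl)+
    then show "distinct (map set ?cells)"
      by (simp only: list.map distinct_length_2_or_more distinct_singleton simp_thms)
    have "\<forall>x\<in>set ?cells. length x = Suc 3 \<and> distinct x \<and> set x \<in> avoid V F"
      using dist dist' unfolding V_def F_def avoid_def by simp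
    then show "length x = Suc 3 \<and> distinct x \<and> set x \<in> avoid V F" if "x \<in> set ?cells" for x
      using that by (rule bspec)
    have "\<forall>x\<in>set ?cells. \<forall>v\<in>V - set x. \<exists>\<phi>\<in>F. \<phi> \<subseteq> insert v (set x)"
      unfolding V_def F_def using dist dist' by (simp add: insert_Diff_if)
    from bspec[OF bspec[OF this]] show "\<exists>\<phi>\<in>F. \<phi> \<subseteq> insert v (set x)" if "x \<in> set ?cells" "v \<in> V - set x" for x v
      using that .
  qed (use dist dist' in \<open>auto simp: V_def F_def\<close>)
  then show ?thesis
    by (simp add: numeral_2_eq_2)
qed

section \<open>Edges and claws of the two small wheels\<close>

lemma card_three_subset: "\<phi> \<subseteq> {x, y, z} \<Longrightarrow> card \<phi> = 3 \<Longrightarrow> \<phi> = {x, y, z}"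
  using card_length[of "[x, y, z]"] by (intro card_seteq) simp_all

lemma clawsE:
  assumes "\<phi> \<in> claws E"
  obtains v where "v \<in> \<Union>E" "\<phi> \<subseteq> {e \<in> E. v \<in> e}" "card \<phi> = 3"
proof -
  obtain v where \<phi>: "\<phi> \<subseteq> E" "card \<phi> = 3" "\<forall>e\<in>\<phi>. v \<in> e"
    using assms unfolding claws_def by blast
  moreover have "\<phi> \<noteq> {}"
    using \<phi>(2) by auto
  ultimately show ?thesis
    by (intro that[of v]) blast+
qed

lemma Collect_mem_insert:
  "{e \<in> insert a A. P e} = (if P a then insert a {e \<in> A. P e} else {e \<in> A. P e})"
  by auto

text \<open>All four vertices have degree 3, so each carries exactly one claw.\<close>

lemma wheel_4:
  "wheel_edges 4 = {{0, 1}, {0, 2}, {0, 3}, {1, 2}, {2, 3}, {3, 1}}" (is "_ = ?E")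
  "claws (wheel_edges 4) = {{{0, 1}, {0, 2}, {0, 3}}, {{0, 1}, {3, 1}, {1, 2}}, {{0, 2}, {1, 2}, {2, 3}},
     {{0, 3}, {2, 3}, {3, 1}}}" (is "_ = ?F")
proof -
  have "{1..3} = {1, 2, 3::nat}"
    by auto
  then show E: "wheel_edges 4 = ?E"
    using wheel_edges_eq[of 3] by (simp add: spoke_def rim_def next_rim_def insert_commute flip: numeral_2_eq_2)
  show "claws (wheel_edges 4) = ?F"
    unfolding E
  proof (rule equalityI)
    show "?F \<subseteq> claws ?E"
      by (simp add: claws_def doubleton_eq_iff conj_disj_distribL conj_disj_distribR ex_disj_distrib)
    show "claws ?E \<subseteq> ?F"
    proof
      fix \<phi> assume "\<phi> \<in> claws ?E"
      then obtain v where v: "v \<in> \<Union>?E" and star: "\<phi> \<subseteq> {e \<in> ?E. v \<in> e}" and card: "card \<phi> = 3"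
        by (rule clawsE)
      from v have "v = 0 \<or> v = 1 \<or> v = 2 \<or> v = 3"
        by simp linarith
      then consider "v = 0" | "v = 1" | "v = 2" | "v = 3"
        by (elim disjE)
      then show "\<phi> \<in> ?F"
      proof cases
        case 1
        have "\<phi> \<subseteq> {{0, 1}, {0, 2}, {0, 3}}"
          using star unfolding 1 Collect_mem_insert by (simp add: insert_commute)
        from card_three_subset[OF this card] show ?thesis by (simp only: insert_iff simp_thms)
      next
        case 2
        have "\<phi> \<subseteq> {{0, 1}, {3, 1}, {1, 2}}"
          using star unfolding 2 Collect_mem_insert by (simp add: insert_commute)
        from card_three_subset[OF this card] show ?thesis by (simp only: insert_iff simp_thms)
      next
        case 3
        have "\<phi> \<subseteq> {{0, 2}, {1, 2}, {2, 3}}"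
          using star unfolding 3 Collect_mem_insert by (simp add: insert_commute)
        from card_three_subset[OF this card] show ?thesis by (simp only: insert_iff simp_thms)
      next
        case 4
        have "\<phi> \<subseteq> {{0, 3}, {2, 3}, {3, 1}}"
          using star unfolding 4 Collect_mem_insert by (simp add: insert_commute)
        from card_three_subset[OF this card] show ?thesis by (simp only: insert_iff simp_thms)
      qed
    qed
  qed
qed

text \<open>Rim vertices have degree 3 and carry one claw each; the hub has degree 4 and carries
  four, one for each omitted spoke.\<close>

lemma wheel_5:
  "wheel_edges 5 = {{0, 1}, {0, 2}, {0, 3}, {0, 4}, {1, 2}, {2, 3}, {3, 4}, {4, 1}}" (is "_ = ?E")
  "claws (wheel_edges 5) = {{{0, 1}, {0, 2}, {0, 3}}, {{0, 1}, {0, 2}, {0, 4}}, {{0, 1}, {0, 3}, {0, 4}},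
     {{0, 2}, {0, 3}, {0, 4}}, {{0, 1}, {4, 1}, {1, 2}}, {{0, 2}, {1, 2}, {2, 3}},
     {{0, 3}, {2, 3}, {3, 4}}, {{0, 4}, {3, 4}, {4, 1}}}" (is "_ = ?F")
proof -
  have "{1..4} = {1, 2, 3, 4::nat}"
    by auto
  then show E: "wheel_edges 5 = ?E"
    using wheel_edges_eq[of 4] by (simp add: spoke_def rim_def next_rim_def insert_commute flip: numeral_2_eq_2)
  show "claws (wheel_edges 5) = ?F"
    unfolding E
  proof (rule equalityI)
    show "?F \<subseteq> claws ?E"
      by (simp add: claws_def doubleton_eq_iff conj_disj_distribL conj_disj_distribR ex_disj_distrib)
    show "claws ?E \<subseteq> ?F"
    proof
      fix \<phi> assume "\<phi> \<in> claws ?E"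
      then obtain v where v: "v \<in> \<Union>?E" and star: "\<phi> \<subseteq> {e \<in> ?E. v \<in> e}" and card: "card \<phi> = 3"
        by (rule clawsE)
      from v have "v = 0 \<or> v = 1 \<or> v = 2 \<or> v = 3 \<or> v = 4"
        by simp linarith
      then consider "v = 0" | "v = 1" | "v = 2" | "v = 3" | "v = 4"
        by (elim disjE)
      then show "\<phi> \<in> ?F"
      proof cases
        case 1
        have sub: "\<phi> \<subseteq> {{0, 1}, {0, 2}, {0, 3}, {0, 4}}"
          using star unfolding 1 Collect_mem_insert by (simp add: insert_commute)
        have "\<phi> \<noteq> {{0, 1}, {0, 2}, {0, 3}, {0, 4}}"
          using card by (auto simp: doubleton_eq_iff)
        then consider "{0, 1} \<notin> \<phi>" | "{0, 2} \<notin> \<phi>" | "{0, 3} \<notin> \<phi>" | "{0, 4} \<notin> \<phi>"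
          using sub by blast
        then show ?thesis
        proof cases
          case 1
          then have "\<phi> \<subseteq> {{0, 2}, {0, 3}, {0, 4}}" using sub by blast
          from card_three_subset[OF this card] show ?thesis by (simp only: insert_iff simp_thms)
        next
          case 2
          then have "\<phi> \<subseteq> {{0, 1}, {0, 3}, {0, 4}}" using sub by blast
          from card_three_subset[OF this card] show ?thesis by (simp only: insert_iff simp_thms)
        next
          case 3
          then have "\<phi> \<subseteq> {{0, 1}, {0, 2}, {0, 4}}" using sub by blast
          from card_three_subset[OF this card] show ?thesis by (simp only: insert_iff simp_thms)
        next
          case 4
          then have "\<phi> \<subseteq> {{0, 1}, {0, 2}, {0, 3}}" using sub by blast
          from card_three_subset[OF this card] show ?thesis by (simp only: insert_iff simp_thms)
        qed
      next
        case 2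
        have "\<phi> \<subseteq> {{0, 1}, {4, 1}, {1, 2}}"
          using star unfolding 2 Collect_mem_insert by (simp add: insert_commute)
        from card_three_subset[OF this card] show ?thesis by (simp only: insert_iff simp_thms)
      next
        case 3
        have "\<phi> \<subseteq> {{0, 2}, {1, 2}, {2, 3}}"
          using star unfolding 3 Collect_mem_insert by (simp add: insert_commute)
        from card_three_subset[OF this card] show ?thesis by (simp only: insert_iff simp_thms)
      next
        case 4
        have "\<phi> \<subseteq> {{0, 3}, {2, 3}, {3, 4}}"
          using star unfolding 4 Collect_mem_insert by (simp add: insert_commute)
        from card_three_subset[OF this card] show ?thesis by (simp only: insert_iff simp_thms)
      next
        case 5
        have "\<phi> \<subseteq> {{0, 4}, {3, 4}, {4, 1}}"
          using star unfolding 5 Collect_mem_insert by (simp add: insert_commute)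
        from card_three_subset[OF this card] show ?thesis by (simp only: insert_iff simp_thms)
      qed
    qed
  qed
qed

theorem mainTheorem3:
  fixes n :: nat
  assumes "n \<ge> 4"
  shows "(n = 4 \<longrightarrow>
            realization_space (wheel_edges n) (two_matching_complex (wheel_edges n))
              homotopy_equivalent_space wedge_spheres 3 2)
       \<and> (n = 5 \<longrightarrow>
            realization_space (wheel_edges n) (two_matching_complex (wheel_edges n))
              homotopy_equivalent_space wedge_spheres 2 3)
       \<and> (n \<ge> 6 \<longrightarrow>
            realization_space (wheel_edges n) (two_matching_complex (wheel_edges n))
              homotopy_equivalent_space discrete_topology {()})"
proof (intro conjI impI)
  have eq: "realization_space (wheel_edges k) (two_matching_complex (wheel_edges k)) =
      top_of_set (realization (wheel_edges k) (avoid (wheel_edges k) (claws (wheel_edges k))))" if "4 \<le> k" for k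
    using finite_wheel_edges[of "k - 1"] that by (simp add: realization_space_eq two_matching_complex_avoid)
  \<comment> \<open>The empty set serves as the new vertex \<open>p\<close>: it has the type of an
    edge but is not one.\<close>
  have "distinct [{0, 1}, {0, 2}, {0, 3}, {1, 2}, {2, 3}, {3, 1}, {}::nat set]"
    by (simp add: doubleton_eq_iff)
  note three_two_spheres[OF this, folded wheel_4]
  then show "realization_space (wheel_edges n) (two_matching_complex (wheel_edges n))
      homotopy_equivalent_space wedge_spheres 3 2" if "n = 4"
    unfolding that wedge_spheres_eq using eq[of 4] by simp
  have "distinct [{0, 1}, {0, 2}, {0, 3}, {0, 4}, {1, 2}, {2, 3}, {3, 4}, {4, 1}, {}::nat set]"
    by (simp add: doubleton_eq_iff)
  note two_three_spheres[OF this, folded wheel_5]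
  then show "realization_space (wheel_edges n) (two_matching_complex (wheel_edges n))
      homotopy_equivalent_space wedge_spheres 2 3" if "n = 5"
    unfolding that wedge_spheres_eq using eq[of 5] by simp
  show "realization_space (wheel_edges n) (two_matching_complex (wheel_edges n))
      homotopy_equivalent_space discrete_topology {()}" if "6 \<le> n"
    using wheel_contractible[of "n - 1"] that by simp
qed

end
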